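(* Let $a<b$ be real numbers and $I=(a,b)$. Let $V:\mathbb R\times\mathbb R\to\mathbb R$ be coercive, lower semicontinuous, diagonal and symmetric, and let $J_{1d}$ be the functional defined on $W^{1,\infty}(I)$ by $$J_{1d}(u):=\operatorname*{ess\,sup}_{(x,y)\in I\times I}V(u'(x),u'(y)).$$ Then $J_{1d}$ is (sequentially) lower semicontinuous with respect to the $W^{1,\infty}$-weak* topology if and only if $V$ is separately level convex.
   Context: For a function $V:\mathbb R\times\mathbb R\to\mathbb R$ and $c\in\mathbb R$, let $L_c(V):=\{(\xi,\eta)\in\mathbb R\times\mathbb R: V(\xi,\eta)\le c\}$. $V$ is coercive if there is $C'>0$ with $C'|(\xi,\eta)|\le V(\xi,\eta)$ for all $\xi,\eta\in\mathbb R$. $V$ is symmetric if $V(\xi,\eta)=V(\eta,\xi)$ for all $\xi,\eta$. $V$ is diagonal if for every $c\in\mathbb R$, $(\xi,\eta)\in L_c(V)$ implies $(\xi,\xi),(\eta,\eta)\in L_c(V)$; equivalently $V(\xi,\eta)=\max\{V(\xi,\xi),V(\xi,\eta),V(\eta,\eta)\}$ for all $\xi,\eta$. A set $A\subset\mathbb R\times\mathbb R$ is separately convex if for all $(\xi_1,\xi_2),(\eta_1,\eta_2)\in A$ with $\xi_1=\eta_1$ or $\xi_2=\eta_2$ one has $t(\xi_1,\xi_2)+(1-t)(\eta_1,\eta_2)\in A$ for every $t\in(0,1)$. $V$ is separately level convex if $L_c(V)$ is separately convex for every $c\in\mathbb R$. Weak* convergence $u_j\overset{*}{\rightharpoonup}u$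 in $W^{1,\infty}(I)$ means $u_j\overset{*}{\rightharpoonup}u$ and $u_j'\overset{*}{\rightharpoonup}u'$ in $L^\infty(I)$. Sequential lower semicontinuity of $J_{1d}$ means $J_{1d}(u)\le\liminf_{j\to\infty}J_{1d}(u_j)$ whenever $u_j\overset{*}{\rightharpoonup}u$ in $W^{1,\infty}(I)$. The functional $J_{1d}$ is allowed to take the value $+\infty$. *)

theory Defs
  imports "HOL-Analysis.Analysis" "HOL-Probability.Essential_Supremum"
begin

section \<open>Properties of the supremand\<close>

definition sublevel :: "(real \<times> real \<Rightarrow> real) \<Rightarrow> real \<Rightarrow> (real \<times> real) set" where
  "sublevel V c = {p. V p \<le> c}"

definition coercive :: "(real \<times> real \<Rightarrow> real) \<Rightarrow> bool" where
  "coercive V \<longleftrightarrow> (\<exists>C'>0. \<forall>\<xi> \<eta>. C' * norm (\<xi>, \<eta>) \<le> V (\<xi>, \<eta>))"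

definition lower_semicontinuous :: "(real \<times> real \<Rightarrow> real) \<Rightarrow> bool" where
  "lower_semicontinuous V \<longleftrightarrow> (\<forall>p. ereal (V p) \<le> Liminf (at p) (\<lambda>q. ereal (V q)))"

definition symmetric :: "(real \<times> real \<Rightarrow> real) \<Rightarrow> bool" where
  "symmetric V \<longleftrightarrow> (\<forall>\<xi> \<eta>. V (\<xi>, \<eta>) = V (\<eta>, \<xi>))"

definition diagonal :: "(real \<times> real \<Rightarrow> real) \<Rightarrow> bool" where
  "diagonal V \<longleftrightarrow>
    (\<forall>c \<xi> \<eta>. (\<xi>, \<eta>) \<in> sublevel V c \<longrightarrow> (\<xi>, \<xi>) \<in> sublevel V c \<and> (\<eta>, \<eta>) \<in> sublevel V c)"

definition separately_convex :: "(real \<times> real) set \<Rightarrow> bool" where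
  "separately_convex A \<longleftrightarrow>
    (\<forall>\<xi>\<^sub>1 \<xi>\<^sub>2 \<eta>\<^sub>1 \<eta>\<^sub>2. (\<xi>\<^sub>1, \<xi>\<^sub>2) \<in> A \<longrightarrow> (\<eta>\<^sub>1, \<eta>\<^sub>2) \<in> A \<longrightarrow> \<xi>\<^sub>1 = \<eta>\<^sub>1 \<or> \<xi>\<^sub>2 = \<eta>\<^sub>2 \<longrightarrow>
      (\<forall>t\<in>{0<..<1}. t *\<^sub>R (\<xi>\<^sub>1, \<xi>\<^sub>2) + (1 - t) *\<^sub>R (\<eta>\<^sub>1, \<eta>\<^sub>2) \<in> A))"

definition separately_level_convex :: "(real \<times> real \<Rightarrow> real) \<Rightarrow> bool" where
  "separately_level_convex V \<longleftrightarrow> (\<forall>c. separately_convex (sublevel V c))"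


section \<open>The Sobolev space and its weak* convergence\<close>

text \<open>
  Elements of the Lebesgue and Sobolev spaces on an open set \<open>I\<close> are represented by functions
  on the whole real line whose values outside \<open>I\<close> are irrelevant. All notions below are
  invariant under changes on null sets, so no quotient is taken.
\<close>

definition Linf :: "real set \<Rightarrow> (real \<Rightarrow> real) set" where
  "Linf I = {f. f \<in> borel_measurable (lebesgue_on I) \<and> (\<exists>C. AE x in lebesgue_on I. \<bar>f x\<bar> \<le> C)}"

text \<open>The smooth functions with compact support in \<open>I\<close>.\<close>

definition test_functions :: "real set \<Rightarrow> (real \<Rightarrow> real) set" where
  "test_functions I = {\<phi>. (\<forall>n x. (deriv ^^ n) \<phi> differentiable at x) \<and>
     compact (closure {x. \<phi> x \<noteq> 0}) \<and> closure {x. \<phi> x \<noteq> 0} \<subseteq> I}"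

definition is_weak_deriv :: "real set \<Rightarrow> (real \<Rightarrow> real) \<Rightarrow> (real \<Rightarrow> real) \<Rightarrow> bool" where
  "is_weak_deriv I u g \<longleftrightarrow> (\<forall>\<phi>\<in>test_functions I.
     (LINT x|lebesgue_on I. u x * deriv \<phi> x) = - (LINT x|lebesgue_on I. g x * \<phi> x))"

definition W1inf :: "real set \<Rightarrow> (real \<Rightarrow> real) set" where
  "W1inf I = {u \<in> Linf I. \<exists>g\<in>Linf I. is_weak_deriv I u g}"

text \<open>A representative of the weak derivative, which is unique up to null sets.\<close>

definition weak_deriv :: "real set \<Rightarrow> (real \<Rightarrow> real) \<Rightarrow> real \<Rightarrow> real" where
  "weak_deriv I u = (SOME g. g \<in> Linf I \<and> is_weak_deriv I u g)"

text \<open>Weak* convergence in \<open>L\<^sup>\<infinity>(I)\<close>, regarded as the dual of \<open>L\<^sup>1(I)\<close>.\<close>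

definition weakstar_Linf :: "real set \<Rightarrow> (nat \<Rightarrow> real \<Rightarrow> real) \<Rightarrow> (real \<Rightarrow> real) \<Rightarrow> bool" where
  "weakstar_Linf I f g \<longleftrightarrow> (\<forall>h. integrable (lebesgue_on I) h \<longrightarrow>
     (\<lambda>j. LINT x|lebesgue_on I. f j x * h x) \<longlonglongrightarrow> (LINT x|lebesgue_on I. g x * h x))"

definition weakstar_W1inf :: "real set \<Rightarrow> (nat \<Rightarrow> real \<Rightarrow> real) \<Rightarrow> (real \<Rightarrow> real) \<Rightarrow> bool" where
  "weakstar_W1inf I U u \<longleftrightarrow>
     weakstar_Linf I U u \<and> weakstar_Linf I (\<lambda>j. weak_deriv I (U j)) (weak_deriv I u)"

definition weakstar_seq_lsc :: "real set \<Rightarrow> ((real \<Rightarrow> real) \<Rightarrow> ereal) \<Rightarrow> bool" where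
  "weakstar_seq_lsc I J \<longleftrightarrow> (\<forall>U u. (\<forall>j. U j \<in> W1inf I) \<longrightarrow> u \<in> W1inf I \<longrightarrow>
     weakstar_W1inf I U u \<longrightarrow> J u \<le> liminf (\<lambda>j. J (U j)))"


section \<open>The supremal functional\<close>

definition J1d :: "(real \<times> real \<Rightarrow> real) \<Rightarrow> real set \<Rightarrow> (real \<Rightarrow> real) \<Rightarrow> ereal" where
  "J1d V I u = esssup (lebesgue_on (I \<times> I))
     (\<lambda>(x, y). ereal (V (weak_deriv I u x, weak_deriv I u y)))"

end

theory Submission
  imports Defs
begin

text \<open>
  A bound \<open>J u \<le> c\<close> says that \<open>(u' x, u' y)\<close> lies in the sublevel set \<open>K\<close> of \<open>V\<close> at \<open>c\<close> for almost all
  \<open>(x, y)\<close> (\<open>J1d_le_iff\<close>). So lower semicontinuity means that this nonlocal inclusion is preserved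
  under weak* limits, for every \<open>c\<close>; the sets \<open>K\<close> are closed, symmetric, and with \<open>(\<xi>, \<eta>)\<close> contain
  \<open>(\<xi>, \<xi>)\<close> and \<open>(\<eta>, \<eta>)\<close>.
  
  Suppose that \<open>K\<close> is separately convex. If the inclusion holds for \<open>v\<close>, then Jensen's argument in
  each variable separately shows that the pair of the averages of \<open>v\<close> over two arbitrary sets of positive
  measure lies in \<open>K\<close> (\<open>averages_mem_separately_convex\<close>). Averages pass to weak* limits and
  determine a function up to null sets, so the inclusion holds for the limit
  (\<open>separately_convex_weakstar_closed\<close>).
  
  Conversely, let \<open>J\<close> be lower semicontinuous and \<open>(\<xi>, \<eta>)\<close> be in \<open>K\<close>. Then \<open>{\<xi>, \<eta>} \<times> {\<xi>, \<eta>}\<close> is contained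
  in \<open>K\<close>, so derivatives with the two values \<open>\<xi>\<close> and \<open>\<eta>\<close> are admissible. Fast oscillation on one half of the
  interval and the constant \<open>\<eta>\<close> on the other one yield in the limit that \<open>K\<close> contains \<open>(\<zeta>, \<eta>)\<close>
  for every \<open>\<zeta>\<close> between \<open>\<xi>\<close> and \<open>\<eta>\<close> (\<open>segment_mem_sublevel_if_lsc\<close>). On the line this already implies
  separate convexity (\<open>separately_convexI_symmetric\<close>), because a point between \<open>\<eta>1\<close> and \<open>\<eta>2\<close>
  lies between \<open>\<eta>1\<close> and \<open>\<xi>\<close> or between \<open>\<eta>2\<close> and \<open>\<xi>\<close>.
  
  For the second part the derivatives of the oscillating functions have to be identified. This takes
  smooth functions with compact support (\<open>bump\<close>), uniqueness of weak derivatives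
  (\<open>weak_deriv_unique\<close>), integration by parts for primitives of bounded functions
  (\<open>is_weak_deriv_primitive\<close>), and the reduction of weak* convergence to intervals
  (\<open>weakstar_LinfI\<close>).
\<close>

section \<open>Smooth functions with compact support\<close>

text \<open>
  The quotients \<open>p / q ^ k\<close> in front of the exponential are there to make the family closed under
  differentiation; the bump functions themselves are the case \<open>p = 1\<close>, \<open>k = 0\<close>.
\<close>
definition flat_exp :: "real poly \<Rightarrow> real poly \<Rightarrow> nat \<Rightarrow> real \<Rightarrow> real" where
  "flat_exp q p k x = (if poly q x > 0 then poly p x / poly q x ^ k * exp (- 1 / poly q x) else 0)"

text \<open>
  A single term of the exponential series at \<open>1 / y\<close> already bounds \<open>exp (1 / y)\<close> from below.
\<close>
lemma exp_minus_inverse_le_power: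
  fixes y :: real
  assumes "y > 0"
  shows "exp (- 1 / y) \<le> fact n * y ^ n"
proof -
  have "(\<lambda>i. inverse (fact i) * (1 / y) ^ i) sums exp (1 / y)"
    using exp_converges[of "1 / y"] by (simp add: scaleR_conv_of_real)
  then have "inverse (fact n) * (1 / y) ^ n \<le> exp (1 / y)"
    using assms sum_le_suminf[of "\<lambda>i. inverse (fact i) * (1 / y) ^ i" "{n}"]
    by (auto simp: sums_iff)
  then have "exp (- (1 / y)) * (inverse (fact n) * (1 / y) ^ n) \<le> exp (- (1 / y)) * exp (1 / y)"
    by (intro mult_left_mono) auto
  then have "exp (- (1 / y)) * (inverse (fact n) * (1 / y) ^ n) \<le> 1"
    by (simp add: exp_minus)
  then show ?thesis
    using assms by (simp add: field_simps)
qed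

text \<open>
  The exponential beats the pole: two powers of \<open>q\<close> are left over, so that the function vanishes
  to second order at the zeros of \<open>q\<close>. This is what makes it differentiable there.
\<close>
lemma flat_exp_bound:
  "\<bar>flat_exp q p k x\<bar> \<le> \<bar>poly p x * fact (k + 2) * poly q x ^ 2\<bar>"
proof (cases "poly q x > 0")
  case True
  let ?y = "poly q x"
  have "\<bar>flat_exp q p k x\<bar> = \<bar>poly p x\<bar> / ?y ^ k * exp (- 1 / ?y)"
    using True by (simp add: flat_exp_def abs_mult)
  also have "\<dots> \<le> \<bar>poly p x\<bar> / ?y ^ k * (fact (k + 2) * ?y ^ (k + 2))"
    using True by (intro mult_left_mono exp_minus_inverse_le_power) auto
  also have "\<dots> = \<bar>poly p x * fact (k + 2) * ?y ^ 2\<bar>"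
    using True by (simp add: abs_mult power_add power2_eq_square del: fact_Suc)
  finally show ?thesis .
qed (simp add: flat_exp_def)

lemma flat_exp_has_derivative:
  "(flat_exp q p k has_real_derivative
     flat_exp q (q\<^sup>2 * pderiv p - of_nat k * p * pderiv q * q + p * pderiv q) (k + 2) x) (at x)"
proof -
  consider "poly q x > 0" | "poly q x < 0" | "poly q x = 0" by linarith
  then show ?thesis
  proof cases
    case 1
    have op: "open {y. poly q y > 0}"
      by (intro open_Collect_less continuous_intros)
    have "((\<lambda>y. poly p y / poly q y ^ k * exp (- 1 / poly q y)) has_real_derivative
       flat_exp q (q\<^sup>2 * pderiv p - of_nat k * p * pderiv q * q + p * pderiv q) (k + 2) x) (at x)"
      using 1 by (auto intro!: derivative_eq_intros simp: flat_exp_def)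
        (cases k; auto simp: field_simps power2_eq_square)
    then show ?thesis
      by (rule has_field_derivative_transform_within_open[OF _ op]) (use 1 in \<open>auto simp: flat_exp_def\<close>)
  next
    case 2
    have op: "open {y. poly q y < 0}"
      by (intro open_Collect_less continuous_intros)
    have "((\<lambda>y. 0) has_real_derivative 0) (at x)" by simp
    then have "(flat_exp q p k has_real_derivative 0) (at x)"
      by (rule has_field_derivative_transform_within_open[OF _ op]) (use 2 in \<open>auto simp: flat_exp_def\<close>)
    then show ?thesis using 2 by (simp add: flat_exp_def)
  next
    case 3
    \<comment> \<open>The majorant \<open>g\<close> is a polynomial with a multiple zero at \<open>x\<close>, so its difference quotient tends to \<open>0\<close>.\<close>
    define g where "g y = poly p y * fact (k + 2) * poly q y ^ 2" for y
    have bound: "\<bar>flat_exp q p k y\<bar> \<le> \<bar>g y\<bar>" for y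
      unfolding g_def by (rule flat_exp_bound)
    have "(g has_real_derivative 0) (at x)"
      unfolding g_def using 3 by (auto intro!: derivative_eq_intros)
    moreover have "g x = 0" using 3 by (simp add: g_def)
    ultimately have lim: "((\<lambda>y. \<bar>g y / (y - x)\<bar>) \<longlongrightarrow> 0) (at x)"
      by (intro tendsto_rabs_zero) (simp add: has_field_derivative_iff)
    have "((\<lambda>y. flat_exp q p k y / (y - x)) \<longlongrightarrow> 0) (at x)"
      by (rule Lim_null_comparison[OF _ lim])
        (auto intro!: always_eventually divide_right_mono bound)
    then show ?thesis
      using 3 by (simp add: has_field_derivative_iff flat_exp_def)
  qed
qed

lemma iterated_deriv_flat_exp: "\<exists>p' k'. (deriv ^^ n) (flat_exp q p k) = flat_exp q p' k'"
proof (induction n)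
  case (Suc n)
  then obtain p' k' where "(deriv ^^ n) (flat_exp q p k) = flat_exp q p' k'" by blast
  then have "(deriv ^^ Suc n) (flat_exp q p k) =
      flat_exp q (q\<^sup>2 * pderiv p' - of_nat k' * p' * pderiv q * q + p' * pderiv q) (k' + 2)"
    using DERIV_imp_deriv[OF flat_exp_has_derivative] by auto
  then show ?case by blast
qed auto

lemma flat_exp_smooth: "(deriv ^^ n) (flat_exp q p k) differentiable at x"
  using iterated_deriv_flat_exp[of n q p k] flat_exp_has_derivative
  by (metis real_differentiable_def)

lemma flat_exp_test_function:
  assumes "compact {x. poly q x \<ge> 0}" and "{x. poly q x \<ge> 0} \<subseteq> I"
  shows "flat_exp q p k \<in> test_functions I"
proof -
  have cl: "closure {x. flat_exp q p k x \<noteq> 0} \<subseteq> {x. poly q x \<ge> 0}"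
    by (rule closure_minimal)
      (auto simp: flat_exp_def split: if_splits intro: compact_imp_closed[OF assms(1)])
  then have "compact (closure {x. flat_exp q p k x \<noteq> 0})"
    using assms(1) by (metis closed_closure compact_Int_closed inf.absorb_iff2 inf.commute)
  with cl assms(2) flat_exp_smooth show ?thesis
    by (auto simp: test_functions_def)
qed

text \<open>
  As \<open>n\<close> grows, \<open>n (x - \<alpha>) (\<beta> - x) - 1\<close> tends to infinity on the open interval and the bumps increase
  to its indicator. The constant \<open>- 1\<close> keeps the supports compact inside the open interval, even if
  its end points are end points of the domain.
\<close>

definition bump_poly :: "real \<Rightarrow> real \<Rightarrow> nat \<Rightarrow> real poly" where
  "bump_poly \<alpha> \<beta> n = smult (real n) ([:- \<alpha>, 1:] * [:\<beta>, - 1:]) - [:1:]"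

definition bump :: "real \<Rightarrow> real \<Rightarrow> nat \<Rightarrow> real \<Rightarrow> real" where
  "bump \<alpha> \<beta> n = flat_exp (bump_poly \<alpha> \<beta> n) 1 0"

lemma poly_bump_poly: "poly (bump_poly \<alpha> \<beta> n) x = real n * ((x - \<alpha>) * (\<beta> - x)) - 1"
  by (simp add: bump_poly_def algebra_simps)

lemma bump_poly_nonneg_imp:
  assumes "\<alpha> \<le> \<beta>" "poly (bump_poly \<alpha> \<beta> n) x \<ge> 0"
  shows "\<alpha> < x \<and> x < \<beta>"
proof -
  have "real n * ((x - \<alpha>) * (\<beta> - x)) > 0"
    using assms(2) by (simp add: poly_bump_poly)
  then have "(x - \<alpha>) * (\<beta> - x) > 0"
    by (simp add: zero_less_mult_iff)
  then show ?thesis using assms(1) by (auto simp: zero_less_mult_iff)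
qed

lemma bump_test_function:
  assumes "\<alpha> \<le> \<beta>" "{\<alpha><..<\<beta>} \<subseteq> I"
  shows "bump \<alpha> \<beta> n \<in> test_functions I"
proof -
  have sub: "{x. poly (bump_poly \<alpha> \<beta> n) x \<ge> 0} \<subseteq> {\<alpha><..<\<beta>}"
    using bump_poly_nonneg_imp[OF assms(1)] by auto
  have "closed {x. poly (bump_poly \<alpha> \<beta> n) x \<ge> 0}"
    by (intro closed_Collect_le continuous_intros)
  moreover have "bounded {x. poly (bump_poly \<alpha> \<beta> n) x \<ge> 0}"
    using sub bounded_subset by (metis bounded_box box_real(1))
  ultimately have "compact {x. poly (bump_poly \<alpha> \<beta> n) x \<ge> 0}"
    by (simp add: compact_eq_bounded_closed)
  with sub assms(2) show ?thesis
    unfolding bump_def by (intro flat_exp_test_function) auto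
qed

lemma bump_bounded: "\<bar>bump \<alpha> \<beta> n x\<bar> \<le> 1"
  by (auto simp: bump_def flat_exp_def)

lemma bump_tendsto_indicator:
  assumes "\<alpha> \<le> \<beta>"
  shows "(\<lambda>n. bump \<alpha> \<beta> n x) \<longlonglongrightarrow> indicator {\<alpha><..<\<beta>} x"
proof (cases "\<alpha> < x \<and> x < \<beta>")
  case True
  define c where "c = (x - \<alpha>) * (\<beta> - x)"
  have "c > 0" using True by (simp add: c_def)
  have lim: "filterlim (\<lambda>n. real n * c - 1) at_top sequentially"
    using \<open>c > 0\<close> by real_asymp
  have "(\<lambda>n. exp (- 1 / (real n * c - 1))) \<longlonglongrightarrow> 1"
    using \<open>c > 0\<close> by real_asymp
  moreover have "\<forall>\<^sub>F n in sequentially. real n * c - 1 > 0"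
    using lim unfolding filterlim_at_top_dense by blast
  ultimately have "(\<lambda>n. bump \<alpha> \<beta> n x) \<longlonglongrightarrow> 1"
    by (elim Lim_transform_eventually eventually_mono)
      (auto simp: bump_def flat_exp_def poly_bump_poly c_def)
  then show ?thesis using True by simp
next
  case False
  then have "bump \<alpha> \<beta> n x = 0" for n
    using bump_poly_nonneg_imp[OF assms, of n x] by (auto simp: bump_def flat_exp_def)
  then show ?thesis using False by (auto simp: indicator_def)
qed

lemma continuous_on_bump: "continuous_on UNIV (bump \<alpha> \<beta> n)"
  unfolding bump_def continuous_on_eq_continuous_at[OF open_UNIV]
  using DERIV_isCont[OF flat_exp_has_derivative] by blast

section \<open>Weak* convergence of bounded sequences\<close>

text \<open>
  For a uniformly bounded sequence, the sets over which the integrals tend to \<open>0\<close> form a Dynkin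
  system: countable disjoint unions are handled by Tannery's theorem, as the integral over \<open>A\<close> is at
  most \<open>C\<close> times the measure of \<open>A\<close>. Hence they contain the generated \<open>\<sigma>\<close>-algebra, and simple
  functions approximate any integrable weight.
\<close>
lemma (in finite_measure) integral_tendsto_zero_if_on_generator:
  fixes w :: "nat \<Rightarrow> 'a \<Rightarrow> real"
  assumes gen: "sets M = sigma_sets (space M) E" "E \<subseteq> Pow (space M)" "Int_stable E"
    and meas[measurable]: "\<And>j. w j \<in> borel_measurable M"
    and bound: "\<And>j x. \<bar>w j x\<bar> \<le> C"
    and space: "(\<lambda>j. \<integral>x. w j x \<partial>M) \<longlonglongrightarrow> 0"
    and basic: "\<And>A. A \<in> E \<Longrightarrow> (\<lambda>j. \<integral>x. w j x * indicator A x \<partial>M) \<longlonglongrightarrow> 0"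
    and h: "integrable M h"
  shows "(\<lambda>j. \<integral>x. w j x * h x \<partial>M) \<longlonglongrightarrow> 0"
proof -
  have C: "0 \<le> C" using bound[of 0 undefined] by linarith
  have int_w: "integrable M (w j)" for j
    by (rule integrable_const_bound[where B = C]) (auto simp: bound)
  have int_wA: "integrable M (\<lambda>x. w j x * indicator A x)" if "A \<in> sets M" for j A
    using that by (intro integrable_const_bound[where B = C])
      (auto simp: bound C split: split_indicator)
  have sets: "(\<lambda>j. \<integral>x. w j x * indicator A x \<partial>M) \<longlonglongrightarrow> 0" if "A \<in> sets M" for A
    using gen(3,2) that[unfolded gen(1)]
  proof (induction rule: sigma_sets_induct_disjoint)
    case (compl A)
    then have A: "A \<in> sets M" by (simp add: gen(1))
    have "(\<integral>x. w j x * indicator (space M - A) x \<partial>M) = (\<integral>x. w j x \<partial>M) - (\<integral>x. w j x * indicator A x \<partial>M)" for j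
    proof -
      have "(\<integral>x. w j x * indicator (space M - A) x \<partial>M) = (\<integral>x. w j x - w j x * indicator A x \<partial>M)"
        by (rule Bochner_Integration.integral_cong) (auto split: split_indicator)
      then show ?thesis using int_w int_wA[OF A] by simp
    qed
    then show ?case using tendsto_diff[OF space compl.IH] by simp
  next
    case (union A)
    then have A: "A i \<in> sets M" for i by (auto simp: gen(1))
    have sm: "(\<lambda>i. measure M (A i)) sums measure M (\<Union>i. A i)"
      using A union(1) by (intro finite_measure_UNION) auto
    have bd: "\<bar>\<integral>x. w j x * indicator (A i) x \<partial>M\<bar> \<le> C * measure M (A i)" for i j
    proof -
      have "\<bar>\<integral>x. w j x * indicator (A i) x \<partial>M\<bar> \<le> (\<integral>x. \<bar>w j x * indicator (A i) x\<bar> \<partial>M)"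
        by (rule integral_abs_bound)
      also have "\<dots> \<le> (\<integral>x. C * indicator (A i) x \<partial>M)"
      proof (rule integral_mono)
        show "integrable M (\<lambda>x. C * indicator (A i) x)"
          using A by (intro integrable_mult_right integrable_real_indicator) (auto simp: less_top[symmetric])
      qed (use int_wA[OF A] in \<open>auto simp: bound C split: split_indicator\<close>)
      also have "\<dots> = C * measure M (A i)" using A by simp
      finally show ?thesis .
    qed
    have eq: "(\<integral>x. w j x * indicator (\<Union>i. A i) x \<partial>M) = (\<Sum>i. \<integral>x. w j x * indicator (A i) x \<partial>M)" for j
    proof -
      have "(LINT x:(\<Union>i. A i)|M. w j x) = (\<Sum>i. LINT x:A i|M. w j x)"
      proof (rule lebesgue_integral_countable_add)
        show "A i \<inter> A k = {}" if "i \<noteq> k" for i k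
          using union(1) that by (auto simp: disjoint_family_on_def)
        show "set_integrable M (\<Union>i. A i) (w j)"
          unfolding set_integrable_def using int_wA[of "\<Union>i. A i" j] A
          by (auto simp: mult.commute)
      qed (use A in auto)
      then show ?thesis by (simp add: set_lebesgue_integral_def mult.commute)
    qed
    have "(\<lambda>j. \<Sum>i. \<integral>x. w j x * indicator (A i) x \<partial>M) \<longlonglongrightarrow> (\<Sum>i. 0)"
      by (rule tannerys_theorem[where M = "\<lambda>i. C * measure M (A i)", THEN conjunct2, THEN conjunct2])
        (use union(3) bd sm in \<open>auto intro!: summable_mult always_eventually simp: sums_iff\<close>)
    then show ?case by (simp add: eq)
  qed (use basic in auto)
  show ?thesis
    using h
  proof (induction rule: integrable_induct)
    case (base A c)
    then show ?case using tendsto_mult_left_zero[OF sets[of A], of c]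
      by (simp add: mult.assoc[symmetric])
  next
    case (add f g)
    have "integrable M (\<lambda>x. w j x * f x)" if "integrable M f" for j f
      by (rule Bochner_Integration.integrable_bound[where f = "\<lambda>x. C * f x"])
        (use that bound C in \<open>auto simp: abs_mult intro!: mult_mono\<close>)
    then show ?case using tendsto_add[OF add(3,4)] add(1,2)
      by (simp add: distrib_left)
  next
    case (lim f s)
    have int: "integrable M (\<lambda>x. w j x * f x)" if "integrable M f" for j f
      by (rule Bochner_Integration.integrable_bound[where f = "\<lambda>x. C * f x"])
        (use that bound C in \<open>auto simp: abs_mult intro!: mult_mono\<close>)
    have "(\<lambda>i. \<integral>x. \<bar>s i x - f x\<bar> \<partial>M) \<longlonglongrightarrow> (\<integral>x. 0 \<partial>M)"
    proof (rule integral_dominated_convergence[where w = "\<lambda>x. 3 * \<bar>f x\<bar>"])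
      show "AE x in M. (\<lambda>i. \<bar>s i x - f x\<bar>) \<longlonglongrightarrow> 0"
        by (intro AE_I2 tendsto_rabs_zero LIM_zero lim.hyps(2))
      show "AE x in M. norm \<bar>s i x - f x\<bar> \<le> 3 * \<bar>f x\<bar>" for i
      proof (rule AE_I2)
        fix x assume "x \<in> space M"
        from lim.hyps(3)[OF this, of i] show "norm \<bar>s i x - f x\<bar> \<le> 3 * \<bar>f x\<bar>" by simp
      qed
    qed (use lim.hyps in auto)
    then have l1: "(\<lambda>i. C * (\<integral>x. \<bar>s i x - f x\<bar> \<partial>M)) \<longlonglongrightarrow> 0"
      using tendsto_mult_right_zero by fastforce
    show ?case
    proof (rule LIMSEQ_I)
      fix e :: real assume "e > 0"
      then obtain i where i: "C * (\<integral>x. \<bar>s i x - f x\<bar> \<partial>M) < e / 2"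
        using order_tendstoD(2)[OF l1, of "e / 2"] by (auto simp: eventually_sequentially)
      obtain N where N: "\<And>j. j \<ge> N \<Longrightarrow> \<bar>\<integral>x. w j x * s i x \<partial>M\<bar> < e / 2"
        using LIMSEQ_D[OF lim.IH[of i], of "e / 2"] \<open>e > 0\<close> by auto
      have "\<bar>\<integral>x. w j x * f x \<partial>M\<bar> < e" if "j \<ge> N" for j
      proof -
        have "\<bar>(\<integral>x. w j x * s i x \<partial>M) - (\<integral>x. w j x * f x \<partial>M)\<bar> = \<bar>\<integral>x. w j x * (s i x - f x) \<partial>M\<bar>"
          using int lim.hyps(1,4) by (simp add: right_diff_distrib)
        also have "\<dots> \<le> (\<integral>x. \<bar>w j x * (s i x - f x)\<bar> \<partial>M)" by (rule integral_abs_bound)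
        also have "\<dots> \<le> (\<integral>x. C * \<bar>s i x - f x\<bar> \<partial>M)"
          using int[of "\<lambda>x. s i x - f x" j] lim.hyps(1,4)
          by (intro integral_mono integrable_abs) (auto simp: abs_mult bound intro!: mult_right_mono)
        also have "\<dots> < e / 2" using i by simp
        finally show ?thesis using N[OF that] by linarith
      qed
      then show "\<exists>N. \<forall>j\<ge>N. norm ((\<integral>x. w j x * f x \<partial>M) - 0) < e" by auto
    qed
  qed
qed

text \<open>
  Lebesgue measure on an interval, viewed as a finite Borel measure on the whole line. It avoids the
  trace of the Lebesgue \<open>\<sigma>\<close>-algebra, which is not generated by intervals; functions that are only
  Lebesgue measurable are replaced by Borel representatives.
\<close>
abbreviation interval_measure :: "real \<Rightarrow> real \<Rightarrow> real measure" where
  "interval_measure a b \<equiv> density lborel (\<lambda>x. ennreal (indicator {a<..<b} x))"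

lemma AE_lebesgue_on_iff:
  fixes S :: "'a::euclidean_space set"
  assumes "S \<in> sets borel"
  shows "(AE x in lebesgue_on S. P x) \<longleftrightarrow> (AE x in lborel. x \<in> S \<longrightarrow> P x)"
  using assms by (subst AE_restrict_space_iff) (auto simp: AE_completion_iff)

lemma borel_measurable_lebesgue_onI:
  "f \<in> borel_measurable borel \<Longrightarrow> f \<in> borel_measurable (lebesgue_on S)"
  by (auto intro!: measurable_restrict_space1 measurable_completion)

lemma finite_interval_measure: "finite_measure (interval_measure a b)"
proof (rule finite_measureI)
  have "emeasure (interval_measure a b) UNIV = emeasure lborel {a<..<b}"
    by (subst emeasure_density) (auto simp: ennreal_indicator)
  then show "emeasure (interval_measure a b) (space (interval_measure a b)) \<noteq> \<infinity>"
    using emeasure_bounded_finite[of "{a<..<b}"] by simp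
qed

lemma integral_lebesgue_on:
  assumes [measurable]: "f \<in> borel_measurable borel"
  shows "(LINT x|lebesgue_on {a<..<b}. f x) = (LINT x|interval_measure a b. f x :: real)"
    and "integrable (lebesgue_on {a<..<b}) f \<longleftrightarrow> integrable (interval_measure a b) f"
  by (simp_all add: integral_restrict_space integrable_restrict_space integral_density
      integrable_density integral_completion integrable_completion)

lemma integral_interval_measure:
  assumes [measurable]: "f \<in> borel_measurable borel"
  shows "(LINT x|interval_measure a b. f x) = (LINT x|lborel. indicator {a<..<b} x * f x :: real)"
  by (simp add: integral_density)

lemma borel_representative:
  fixes f :: "real \<Rightarrow> real"
  assumes "f \<in> borel_measurable (lebesgue_on {a<..<b})"
  obtains f' where "f' \<in> borel_measurable borel" "AE x in lebesgue_on {a<..<b}. f x = f' x"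
proof -
  let ?f = "\<lambda>x. if x \<in> {a<..<b} then f x else 0"
  have "?f \<in> borel_measurable lebesgue"
    using borel_measurable_if_I[OF assms] by simp
  then obtain f' where "f' \<in> borel_measurable lborel" "AE x in lborel. ?f x = f' x"
    using completion_ex_borel_measurable_real by blast
  then show ?thesis
    by (intro that[of f']) (auto simp: AE_lebesgue_on_iff elim: eventually_mono)
qed

lemma Linf_representative:
  assumes "g \<in> Linf {a<..<b}"
  obtains g' C where "g' \<in> borel_measurable borel" "\<And>x. \<bar>g' x\<bar> \<le> C"
    "AE x in lebesgue_on {a<..<b}. g x = g' x"
proof -
  from assms obtain C where C: "AE x in lebesgue_on {a<..<b}. \<bar>g x\<bar> \<le> C"
    and "g \<in> borel_measurable (lebesgue_on {a<..<b})"
    by (auto simp: Linf_def)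
  then obtain f where [measurable]: "f \<in> borel_measurable borel"
    and f: "AE x in lebesgue_on {a<..<b}. g x = f x"
    using borel_representative by blast
  show ?thesis
  proof (rule that)
    show "(\<lambda>x. if \<bar>f x\<bar> \<le> C then f x else 0) \<in> borel_measurable borel" by measurable
    show "\<bar>if \<bar>f x\<bar> \<le> C then f x else 0\<bar> \<le> \<bar>C\<bar>" for x by auto
    show "AE x in lebesgue_on {a<..<b}. g x = (if \<bar>f x\<bar> \<le> C then f x else 0)"
      using C f by eventually_elim auto
  qed
qed

lemma bounded_borel_Linf:
  assumes "g \<in> borel_measurable borel" "\<And>x. \<bar>g x\<bar> \<le> C"
  shows "g \<in> Linf {a<..<b}"
  using assms by (auto simp: Linf_def intro!: measurable_restrict_space1 exI[of _ C] measurable_completion)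

lemma integral_tendsto_zero_if_on_intervals:
  fixes w :: "nat \<Rightarrow> real \<Rightarrow> real"
  assumes meas[measurable]: "\<And>j. w j \<in> borel_measurable borel"
    and bound: "\<And>j x. \<bar>w j x\<bar> \<le> C"
    and basic: "\<And>\<alpha> \<beta>. a \<le> \<alpha> \<Longrightarrow> \<alpha> \<le> \<beta> \<Longrightarrow> \<beta> \<le> b \<Longrightarrow>
      (\<lambda>j. LINT x|lborel. indicator {\<alpha><..<\<beta>} x * w j x) \<longlonglongrightarrow> 0"
    and h: "integrable (interval_measure a b) h"
  shows "(\<lambda>j. LINT x|interval_measure a b. w j x * h x) \<longlonglongrightarrow> 0"
proof (rule finite_measure.integral_tendsto_zero_if_on_generator[OF finite_interval_measure,
      where E = "range (\<lambda>(c, d). box c d)"])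
  have on_Ioo: "(\<lambda>j. LINT x|interval_measure a b. w j x * indicator {c<..<d} x) \<longlonglongrightarrow> 0" for c d
  proof -
    let ?\<alpha> = "max a c" and ?\<beta> = "min b d"
    have eq: "(LINT x|interval_measure a b. w j x * indicator {c<..<d} x) =
        (LINT x|lborel. indicator {?\<alpha><..<?\<beta>} x * w j x)" for j
      by (subst integral_interval_measure)
        (auto intro!: Bochner_Integration.integral_cong split: split_indicator)
    show ?thesis
    proof (cases "?\<alpha> \<le> ?\<beta>")
      case True
      then show ?thesis unfolding eq by (intro basic) auto
    next
      case False
      then have "{?\<alpha><..<?\<beta>} = {}" by (simp only: greaterThanLessThan_empty not_le less_imp_le)
      then show ?thesis unfolding eq by simp
    qed
  qed
  then show "(\<lambda>j. LINT x|interval_measure a b. w j x * indicator A x) \<longlonglongrightarrow> 0"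
    if "A \<in> range (\<lambda>(c, d). box c d)" for A :: "real set"
    using that by auto
  have "(LINT x|interval_measure a b. w j x) =
      (LINT x|interval_measure a b. w j x * indicator {a<..<b} x)" for j
    by (simp add: integral_interval_measure,
        intro Bochner_Integration.integral_cong) (auto split: split_indicator)
  then show "(\<lambda>j. LINT x|interval_measure a b. w j x) \<longlonglongrightarrow> 0"
    using on_Ioo by simp
  show "sets (interval_measure a b) =
      sigma_sets (space (interval_measure a b)) (range (\<lambda>(c, d). box c d))"
    by (simp add: borel_eq_box)
  show "Int_stable (range (\<lambda>(c, d). box c d :: real set))"
    by (auto simp: Int_stable_def)
qed (use bound h in auto)

lemma weakstar_LinfI:
  assumes [measurable]: "\<And>j. f j \<in> borel_measurable borel" "g \<in> borel_measurable borel"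
    and bound: "\<And>j x. \<bar>f j x\<bar> \<le> C" "\<And>x. \<bar>g x\<bar> \<le> C"
    and basic: "\<And>\<alpha> \<beta>. a \<le> \<alpha> \<Longrightarrow> \<alpha> \<le> \<beta> \<Longrightarrow> \<beta> \<le> b \<Longrightarrow>
      (\<lambda>j. LINT x|lborel. indicator {\<alpha><..<\<beta>} x * (f j x - g x)) \<longlonglongrightarrow> 0"
  shows "weakstar_Linf {a<..<b} f g"
  unfolding weakstar_Linf_def
proof (intro allI impI)
  fix h :: "real \<Rightarrow> real" assume h: "integrable (lebesgue_on {a<..<b}) h"
  then obtain h' where [measurable]: "h' \<in> borel_measurable borel"
    and h': "AE x in lebesgue_on {a<..<b}. h x = h' x"
    using borel_representative[OF borel_measurable_integrable[OF h]] by metis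
  have "integrable (lebesgue_on {a<..<b}) h'"
    by (rule integrable_cong_AE_imp[OF h borel_measurable_lebesgue_onI h']) simp
  then have int: "integrable (interval_measure a b) h'"
    by (simp add: integral_lebesgue_on)
  have eq: "(LINT x|lebesgue_on {a<..<b}. F x * h x) = (LINT x|interval_measure a b. F x * h' x)"
    if [measurable]: "F \<in> borel_measurable borel" for F
  proof -
    have "(LINT x|lebesgue_on {a<..<b}. F x * h x) = (LINT x|lebesgue_on {a<..<b}. F x * h' x)"
    proof (rule integral_cong_AE)
      show "AE x in lebesgue_on {a<..<b}. F x * h x = F x * h' x"
        using h' by eventually_elim simp
      show "(\<lambda>x. F x * h x) \<in> borel_measurable (lebesgue_on {a<..<b})"
        by (intro borel_measurable_times borel_measurable_integrable[OF h]
            borel_measurable_lebesgue_onI that)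
      show "(\<lambda>x. F x * h' x) \<in> borel_measurable (lebesgue_on {a<..<b})"
        by (intro borel_measurable_lebesgue_onI) simp
    qed
    then show ?thesis by (simp add: integral_lebesgue_on)
  qed
  have int_mult: "integrable (interval_measure a b) (\<lambda>x. F x * h' x)"
    if [measurable]: "F \<in> borel_measurable borel" and "\<And>x. \<bar>F x\<bar> \<le> C" for F
  proof (rule Bochner_Integration.integrable_bound[where f = "\<lambda>x. C * h' x"])
    have "0 \<le> C" using that(2)[of 0] by linarith
    then show "AE x in interval_measure a b. norm (F x * h' x) \<le> norm (C * h' x)"
      using that(2) by (intro AE_I2) (simp add: abs_mult mult_right_mono)
  qed (use int in auto)
  have "(\<lambda>j. LINT x|interval_measure a b. (f j x - g x) * h' x) \<longlonglongrightarrow> 0"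
  proof (rule integral_tendsto_zero_if_on_intervals[OF _ _ basic int])
    show "\<bar>f j x - g x\<bar> \<le> 2 * C" for j x
      using bound(1)[of j x] bound(2)[of x] by linarith
  qed auto
  then have "(\<lambda>j. (LINT x|interval_measure a b. f j x * h' x) - (LINT x|interval_measure a b. g x * h' x)) \<longlonglongrightarrow> 0"
    using int_mult bound by (simp add: left_diff_distrib)
  then show "(\<lambda>j. LINT x|lebesgue_on {a<..<b}. f j x * h x) \<longlonglongrightarrow> (LINT x|lebesgue_on {a<..<b}. g x * h x)"
    by (simp add: eq LIM_zero_iff)
qed

section \<open>Weak derivatives\<close>

text \<open>
  The fundamental lemma of the calculus of variations. The difference \<open>d\<close> of two weak derivatives is
  orthogonal to all bumps, hence has integral \<open>0\<close> over every interval. The constant sequence \<open>d\<close>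
  therefore converges to \<open>0\<close> weakly*, and testing with \<open>d\<close> itself gives \<open>\<integral> d\<^sup>2 = 0\<close>.
\<close>

lemma weak_deriv_unique:
  assumes g: "g1 \<in> Linf {a<..<b}" "g2 \<in> Linf {a<..<b}"
    and wd: "is_weak_deriv {a<..<b} u g1" "is_weak_deriv {a<..<b} u g2"
  shows "AE x in lebesgue_on {a<..<b}. g1 x = g2 x"
proof -
  obtain f1 C1 where f1[measurable]: "f1 \<in> borel_measurable borel" and C1: "\<And>x. \<bar>f1 x\<bar> \<le> C1"
    and ae1: "AE x in lebesgue_on {a<..<b}. g1 x = f1 x"
    using Linf_representative[OF g(1)] by metis
  obtain f2 C2 where f2[measurable]: "f2 \<in> borel_measurable borel" and C2: "\<And>x. \<bar>f2 x\<bar> \<le> C2"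
    and ae2: "AE x in lebesgue_on {a<..<b}. g2 x = f2 x"
    using Linf_representative[OF g(2)] by metis
  interpret finite_measure "interval_measure a b" by (rule finite_interval_measure)
  define d where "d x = f1 x - f2 x" for x
  have [measurable]: "d \<in> borel_measurable borel" unfolding d_def by measurable
  have d_bound: "\<bar>d x\<bar> \<le> C1 + C2" for x
    using C1[of x] C2[of x] by (simp add: d_def)
  have bounded_integrable: "integrable (interval_measure a b) F"
    if "F \<in> borel_measurable borel" "\<And>x. \<bar>F x\<bar> \<le> B" for F :: "real \<Rightarrow> real" and B
    by (rule integrable_const_bound[where B = B]) (use that in auto)
  have [measurable]: "bump \<alpha> \<beta> n \<in> borel_measurable borel" for \<alpha> \<beta> n
    using continuous_on_bump by (rule borel_measurable_continuous_onI)
  have bump_zero: "(LINT x|interval_measure a b. d x * bump \<alpha> \<beta> n x) = 0"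
    if "a \<le> \<alpha>" "\<alpha> \<le> \<beta>" "\<beta> \<le> b" for \<alpha> \<beta> n
  proof -
    have test: "bump \<alpha> \<beta> n \<in> test_functions {a<..<b}"
      using that by (intro bump_test_function) auto
    have "integrable (interval_measure a b) (\<lambda>x. f x * bump \<alpha> \<beta> n x)"
      if "f \<in> borel_measurable borel" "\<And>x. \<bar>f x\<bar> \<le> C" for f C
      using that bump_bounded
      by (intro bounded_integrable[where B = "C * 1"]) (auto simp: abs_mult simp del: mult_1_right intro!: mult_mono intro: order_trans[OF abs_ge_zero])
    note int = this[OF f1 C1] this[OF f2 C2]
    have eq: "(LINT x|lebesgue_on {a<..<b}. g x * bump \<alpha> \<beta> n x) = (LINT x|interval_measure a b. f x * bump \<alpha> \<beta> n x)"
      if "f \<in> borel_measurable borel" "g \<in> Linf {a<..<b}" "AE x in lebesgue_on {a<..<b}. g x = f x" for f g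
    proof -
      have "(LINT x|lebesgue_on {a<..<b}. g x * bump \<alpha> \<beta> n x) = (LINT x|lebesgue_on {a<..<b}. f x * bump \<alpha> \<beta> n x)"
      proof (intro integral_cong_AE borel_measurable_times)
        show "g \<in> borel_measurable (lebesgue_on {a<..<b})" using that by (simp add: Linf_def)
        show "AE x in lebesgue_on {a<..<b}. g x * bump \<alpha> \<beta> n x = f x * bump \<alpha> \<beta> n x"
          using that(3) by eventually_elim simp
      qed (use that(1) in \<open>auto intro: borel_measurable_lebesgue_onI\<close>)
      then show ?thesis using that(1) by (simp add: integral_lebesgue_on)
    qed
    have "(LINT x|lebesgue_on {a<..<b}. g1 x * bump \<alpha> \<beta> n x) = (LINT x|lebesgue_on {a<..<b}. g2 x * bump \<alpha> \<beta> n x)"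
      using bspec[OF wd(1)[unfolded is_weak_deriv_def] test] bspec[OF wd(2)[unfolded is_weak_deriv_def] test]
      by linarith
    then show ?thesis
      using int by (simp add: eq[OF f1 g(1) ae1] eq[OF f2 g(2) ae2] d_def left_diff_distrib)
  qed
  have Ioo_zero: "(LINT x|lborel. indicator {\<alpha><..<\<beta>} x * d x) = 0"
    if "a \<le> \<alpha>" "\<alpha> \<le> \<beta>" "\<beta> \<le> b" for \<alpha> \<beta>
  proof -
    have "(\<lambda>n. LINT x|interval_measure a b. d x * bump \<alpha> \<beta> n x) \<longlonglongrightarrow>
        (LINT x|interval_measure a b. d x * indicator {\<alpha><..<\<beta>} x)"
    proof (rule integral_dominated_convergence[where w = "\<lambda>x. C1 + C2"])
      show "AE x in interval_measure a b. norm (d x * bump \<alpha> \<beta> n x) \<le> C1 + C2" for n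
      proof (rule AE_I2)
        fix x
        have "\<bar>d x\<bar> * \<bar>bump \<alpha> \<beta> n x\<bar> \<le> (C1 + C2) * 1"
          using d_bound[of x] by (intro mult_mono d_bound bump_bounded) auto
        then show "norm (d x * bump \<alpha> \<beta> n x) \<le> C1 + C2" by (simp add: abs_mult)
      qed
      show "AE x in interval_measure a b. (\<lambda>n. d x * bump \<alpha> \<beta> n x) \<longlonglongrightarrow> d x * indicator {\<alpha><..<\<beta>} x"
        using bump_tendsto_indicator[OF that(2)] by (intro AE_I2 tendsto_intros) auto
    qed auto
    then have "(LINT x|interval_measure a b. d x * indicator {\<alpha><..<\<beta>} x) = 0"
      using bump_zero[OF that] by (simp add: LIMSEQ_const_iff)
    moreover have "(LINT x|interval_measure a b. d x * indicator {\<alpha><..<\<beta>} x) = (LINT x|lborel. indicator {\<alpha><..<\<beta>} x * d x)"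
      using that by (subst integral_interval_measure)
        (auto intro!: Bochner_Integration.integral_cong split: split_indicator)
    ultimately show ?thesis by simp
  qed
  have int_d: "integrable (interval_measure a b) d"
    by (rule bounded_integrable[OF _ d_bound]) simp
  have "(\<lambda>j::nat. LINT x|interval_measure a b. d x * d x) \<longlonglongrightarrow> 0"
    by (rule integral_tendsto_zero_if_on_intervals[OF _ d_bound _ int_d])
      (use Ioo_zero in auto)
  then have "(LINT x|interval_measure a b. (d x)\<^sup>2) = 0"
    by (simp add: LIMSEQ_const_iff power2_eq_square)
  moreover have "integrable (interval_measure a b) (\<lambda>x. (d x)\<^sup>2)"
    by (rule bounded_integrable[where B = "(C1 + C2)\<^sup>2"])
      (use power_mono[OF d_bound abs_ge_zero, where n = 2] in auto)
  ultimately have "AE x in interval_measure a b. (d x)\<^sup>2 = 0"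
    by (subst integral_nonneg_eq_0_iff_AE[symmetric]) auto
  then have "AE x in lborel. 0 < ennreal (indicator {a<..<b} x) \<longrightarrow> (d x)\<^sup>2 = 0"
    by (subst (asm) AE_density) simp_all
  then have "AE x in lebesgue_on {a<..<b}. d x = 0"
    by (subst AE_lebesgue_on_iff) (auto elim: eventually_mono)
  then show ?thesis
    using ae1 ae2 by eventually_elim (simp add: d_def)
qed

definition primitive :: "real \<Rightarrow> (real \<Rightarrow> real) \<Rightarrow> real \<Rightarrow> real" where
  "primitive a g x = (LINT y|lborel. indicator {a<..<x} y * g y)"

lemma primitive_measurable:
  assumes [measurable]: "g \<in> borel_measurable borel"
  shows "primitive a g \<in> borel_measurable borel"
proof -
  have "(\<lambda>x. LINT y|lborel. (if a < y \<and> y < x then g y else 0)) \<in> borel_measurable borel"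
    by measurable
  moreover have "primitive a g = (\<lambda>x. LINT y|lborel. (if a < y \<and> y < x then g y else 0))"
    by (auto simp: primitive_def fun_eq_iff intro!: Bochner_Integration.integral_cong)
  ultimately show ?thesis by simp
qed

lemma primitive_bound:
  assumes "g \<in> borel_measurable borel" "\<And>x. \<bar>g x\<bar> \<le> C" "a < x" "x < b"
  shows "\<bar>primitive a g x\<bar> \<le> C * (b - a)"
proof -
  have C: "0 \<le> C" using assms(2)[of 0] by linarith
  have i2: "integrable lborel (\<lambda>y. C * indicator {a<..<x} y)"
    using emeasure_bounded_finite[of "{a<..<x}"] by (intro integrable_mult_right integrable_real_indicator) auto
  have "\<bar>primitive a g x\<bar> \<le> (LINT y|lborel. \<bar>indicator {a<..<x} y * g y\<bar>)"
    unfolding primitive_def by (rule integral_abs_bound)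
  also have "\<dots> \<le> (LINT y|lborel. C * indicator {a<..<x} y)"
  proof (rule integral_mono)
    show "integrable lborel (\<lambda>y. \<bar>indicator {a<..<x} y * g y\<bar>)"
      by (rule Bochner_Integration.integrable_bound[OF i2])
        (use assms C in \<open>auto simp: abs_mult split: split_indicator\<close>)
  qed (use assms(2) i2 C in \<open>auto split: split_indicator\<close>)
  also have "\<dots> = C * (x - a)" using assms by simp
  also have "\<dots> \<le> C * (b - a)" using assms C by (intro mult_left_mono) auto
  finally show ?thesis .
qed

lemma primitive_Linf:
  assumes "g \<in> borel_measurable borel" "\<And>x. \<bar>g x\<bar> \<le> C"
  shows "primitive a g \<in> Linf {a<..<b}"
  unfolding Linf_def using primitive_bound[OF assms] primitive_measurable[OF assms(1)]
  by (auto simp: AE_lebesgue_on_iff intro!: borel_measurable_lebesgue_onI exI[of _ "C * (b - a)"])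

text \<open>
  Integration by parts, obtained from Fubini's theorem on the triangle \<open>a < y < x < b\<close>: integrating
  \<open>g y * \<phi>' x\<close> first over \<open>x\<close> leaves \<open>- g y * \<phi> y\<close>, because \<open>\<phi>\<close> vanishes at \<open>b\<close>.
\<close>
lemma is_weak_deriv_primitive:
  assumes g[measurable]: "g \<in> borel_measurable borel" and C: "\<And>x. \<bar>g x\<bar> \<le> C"
  shows "is_weak_deriv {a<..<b} (primitive a g) g"
  unfolding is_weak_deriv_def
proof
  fix \<phi> assume \<phi>: "\<phi> \<in> test_functions {a<..<b}"
  have diff: "(deriv ^^ n) \<phi> differentiable at x" for n x
    using \<phi> by (auto simp: test_functions_def)
  have der: "(\<phi> has_real_derivative deriv \<phi> x) (at x)" for x
    using diff[of 0 x] by (simp add: DERIV_deriv_iff_real_differentiable)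
  have cont': "isCont (deriv \<phi>) x" for x
    using diff[of 1 x] by (simp add: differentiable_imp_continuous_within)
  have [measurable]: "deriv \<phi> \<in> borel_measurable borel"
    by (intro borel_measurable_continuous_onI continuous_at_imp_continuous_on) (use cont' in auto)
  have [measurable]: "\<phi> \<in> borel_measurable borel"
    by (intro borel_measurable_continuous_onI continuous_at_imp_continuous_on) (use DERIV_isCont[OF der] in auto)
  have zero: "\<phi> b = 0"
  proof (rule ccontr)
    assume "\<phi> b \<noteq> 0"
    then have "b \<in> closure {x. \<phi> x \<noteq> 0}" by (intro subsetD[OF closure_subset]) simp
    then show False using \<phi> by (auto simp: test_functions_def)
  qed
  obtain D where D: "\<And>x. x \<in> {a..b} \<Longrightarrow> \<bar>deriv \<phi> x\<bar> \<le> D"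
  proof -
    have "compact (deriv \<phi> ` {a..b})"
      by (intro compact_continuous_image continuous_at_imp_continuous_on) (use cont' in auto)
    then show ?thesis using that
      by (fastforce dest!: compact_imp_bounded simp: bounded_iff)
  qed
  have C0: "0 \<le> C" using C[of 0] by linarith
  define F where "F x y = (if a < y \<and> y < x \<and> x < b then g y * deriv \<phi> x else 0)" for x y
  have [measurable]: "case_prod F \<in> borel_measurable (lborel \<Otimes>\<^sub>M lborel)"
    unfolding F_def by measurable
  have intF: "integrable (lborel \<Otimes>\<^sub>M lborel) (case_prod F)"
  proof (rule integrableI_bounded_set[where A = "{a<..<b} \<times> {a<..<b}" and B = "C * D"])
    show "emeasure (lborel \<Otimes>\<^sub>M lborel) ({a<..<b} \<times> {a<..<b}) < \<infinity>"
      using emeasure_bounded_finite[of "{a<..<b} \<times> {a<..<b}"] by (simp add: lborel_prod bounded_Times)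
    show "AE x in lborel \<Otimes>\<^sub>M lborel. x \<in> {a<..<b} \<times> {a<..<b} \<longrightarrow> norm (case_prod F x) \<le> C * D"
    proof (intro AE_I2 impI)
      fix p assume "p \<in> {a<..<b} \<times> {a<..<b}"
      then have "0 \<le> D" "\<bar>deriv \<phi> (fst p)\<bar> \<le> D"
        using D[of "fst p"] by auto
      then show "norm (case_prod F p) \<le> C * D"
        using C C0 by (auto simp: F_def abs_mult split: prod.splits intro!: mult_mono)
    qed
  next
    show "AE x in lborel \<Otimes>\<^sub>M lborel. x \<notin> {a<..<b} \<times> {a<..<b} \<longrightarrow> case_prod F x = 0"
      by (intro AE_I2) (auto simp: F_def split: if_splits)
  qed auto
  have inner1: "(LINT y|lborel. F x y) = indicator {a<..<b} x * (primitive a g x * deriv \<phi> x)" for x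
  proof -
    have "(LINT y|lborel. F x y) = (LINT y|lborel. (indicator {a<..<x} y * g y) * (indicator {a<..<b} x * deriv \<phi> x))"
      by (intro Bochner_Integration.integral_cong) (auto simp: F_def split: split_indicator)
    then show ?thesis by (simp add: primitive_def)
  qed
  have inner2: "(LINT x|lborel. F x y) = - (indicator {a<..<b} y * (g y * \<phi> y))" for y
  proof (cases "y \<in> {a<..<b}")
    case True
    have "(LINT x|lborel. F x y) = (LINT x|lborel. g y * (deriv \<phi> x * indicator {y..b} x))"
      by (intro integral_cong_AE)
        (use True AE_lborel_singleton[of y] AE_lborel_singleton[of b] in
         \<open>auto simp: F_def split: split_indicator elim!: eventually_rev_mp\<close>)
    also have "\<dots> = g y * (LINT x|lborel. deriv \<phi> x * indicator {y..b} x)" by simp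
    also have "(LINT x|lborel. deriv \<phi> x * indicator {y..b} x) = \<phi> b - \<phi> y"
      using True by (intro integral_FTC_Icc_real der) (auto intro: cont')
    finally show ?thesis using True zero by simp
  next
    case False
    then have "F x y = 0" for x by (auto simp: F_def)
    then show ?thesis using False by simp
  qed
  note [measurable] = primitive_measurable[OF g]
  have "(LINT x|lebesgue_on {a<..<b}. primitive a g x * deriv \<phi> x) = (LINT x|lborel. LINT y|lborel. F x y)"
    by (subst integral_lebesgue_on) (simp_all add: integral_interval_measure inner1)
  also have "\<dots> = (LINT y|lborel. LINT x|lborel. F x y)"
    using lborel_pair.Fubini_integral[OF intF] by simp
  also have "\<dots> = - (LINT x|lebesgue_on {a<..<b}. g x * \<phi> x)"
    by (subst integral_lebesgue_on) (simp_all add: integral_interval_measure inner2)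
  finally show "(LINT x|lebesgue_on {a<..<b}. primitive a g x * deriv \<phi> x) = - (LINT x|lebesgue_on {a<..<b}. g x * \<phi> x)" .
qed

lemma primitive_W1inf:
  assumes "g \<in> borel_measurable borel" "\<And>x. \<bar>g x\<bar> \<le> C"
  shows "primitive a g \<in> W1inf {a<..<b}"
  using primitive_Linf[OF assms, of a b] is_weak_deriv_primitive[OF assms, of a b]
    bounded_borel_Linf[OF assms, of a b]
  by (auto simp: W1inf_def)

lemma weak_deriv_W1inf:
  assumes "u \<in> W1inf I"
  shows "weak_deriv I u \<in> Linf I" "is_weak_deriv I u (weak_deriv I u)"
proof -
  have "\<exists>g. g \<in> Linf I \<and> is_weak_deriv I u g" using assms by (auto simp: W1inf_def)
  from someI_ex[OF this] show "weak_deriv I u \<in> Linf I" "is_weak_deriv I u (weak_deriv I u)"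
    by (auto simp: weak_deriv_def)
qed

lemma weak_deriv_primitive:
  assumes "g \<in> borel_measurable borel" "\<And>x. \<bar>g x\<bar> \<le> C"
  shows "AE x in lebesgue_on {a<..<b}. weak_deriv {a<..<b} (primitive a g) x = g x"
  using weak_deriv_W1inf[OF primitive_W1inf[OF assms]] is_weak_deriv_primitive[OF assms]
    bounded_borel_Linf[OF assms] by (intro weak_deriv_unique)

text \<open>
  The primitives converge pointwise, since their values are integrals over intervals, and boundedly.
  So convergence of the derivatives on intervals is all that has to be checked.
\<close>

lemma weakstar_primitive:
  assumes meas[measurable]: "\<And>j. g j \<in> borel_measurable borel" "f \<in> borel_measurable borel"
    and bound: "\<And>j x. \<bar>g j x\<bar> \<le> C" "\<And>x. \<bar>f x\<bar> \<le> C"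
    and lim: "\<And>\<alpha> \<beta>. a \<le> \<alpha> \<Longrightarrow> \<alpha> \<le> \<beta> \<Longrightarrow> \<beta> \<le> b \<Longrightarrow>
      (\<lambda>j. LINT x|lborel. indicator {\<alpha><..<\<beta>} x * (g j x - f x)) \<longlonglongrightarrow> 0"
  shows "weakstar_W1inf {a<..<b} (\<lambda>j. primitive a (g j)) (primitive a f)"
  unfolding weakstar_W1inf_def
proof
  have int: "integrable lborel (\<lambda>y. indicator {a<..<x} y * h y)"
    if "h \<in> borel_measurable borel" "\<And>x. \<bar>h x\<bar> \<le> C" for h x
  proof -
    have "integrable lborel (\<lambda>y. indicator {a<..<x} y *\<^sub>R h y)"
      by (rule integrableI_bounded_set_indicator[where B = C])
        (use that(2) emeasure_bounded_finite[of "{a<..<x}"] in \<open>auto simp: that(1)\<close>)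
    then show ?thesis by simp
  qed
  have pointwise: "(\<lambda>j. primitive a (g j) x) \<longlonglongrightarrow> primitive a f x" if "a < x" "x < b" for x
  proof -
    have "primitive a (g j) x - primitive a f x = (LINT y|lborel. indicator {a<..<x} y * (g j y - f y))" for j
      using int[OF meas(1) bound(1)] int[OF meas(2) bound(2)]
      by (simp add: primitive_def right_diff_distrib)
    then have "(\<lambda>j. primitive a (g j) x - primitive a f x) \<longlonglongrightarrow> 0"
      using lim[of a x] that by simp
    then show ?thesis by (rule LIM_zero_cancel)
  qed
  show "weakstar_Linf {a<..<b} (\<lambda>j. primitive a (g j)) (primitive a f)"
    unfolding weakstar_Linf_def
  proof (intro allI impI)
    fix h :: "real \<Rightarrow> real" assume h: "integrable (lebesgue_on {a<..<b}) h"
    then have [measurable]: "h \<in> borel_measurable (lebesgue_on {a<..<b})" by auto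
    note [measurable] = borel_measurable_lebesgue_onI[OF primitive_measurable]
    show "(\<lambda>j. LINT x|lebesgue_on {a<..<b}. primitive a (g j) x * h x) \<longlonglongrightarrow>
        (LINT x|lebesgue_on {a<..<b}. primitive a f x * h x)"
    proof (rule integral_dominated_convergence[where w = "\<lambda>x. C * (b - a) * \<bar>h x\<bar>"])
      show "AE x in lebesgue_on {a<..<b}. (\<lambda>j. primitive a (g j) x * h x) \<longlonglongrightarrow> primitive a f x * h x"
        using pointwise by (intro AE_I2 tendsto_mult_right) auto
      show "AE x in lebesgue_on {a<..<b}. norm (primitive a (g j) x * h x) \<le> C * (b - a) * \<bar>h x\<bar>" for j
        using primitive_bound[OF meas(1) bound(1)]
        by (intro AE_I2) (auto simp: abs_mult intro!: mult_right_mono)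
    qed (use h in auto)
  qed
  have wd: "(LINT x|lebesgue_on {a<..<b}. weak_deriv {a<..<b} (primitive a k) x * h x) =
      (LINT x|lebesgue_on {a<..<b}. k x * h x)"
    if "k \<in> borel_measurable borel" "\<And>x. \<bar>k x\<bar> \<le> C" "integrable (lebesgue_on {a<..<b}) h" for k h
  proof (intro integral_cong_AE borel_measurable_times)
    show "weak_deriv {a<..<b} (primitive a k) \<in> borel_measurable (lebesgue_on {a<..<b})"
      using weak_deriv_W1inf(1)[OF primitive_W1inf[OF that(1,2)]] by (simp add: Linf_def)
    show "AE x in lebesgue_on {a<..<b}. weak_deriv {a<..<b} (primitive a k) x * h x = k x * h x"
      using weak_deriv_primitive[OF that(1,2)] by eventually_elim simp
  qed (use that in \<open>auto intro: borel_measurable_lebesgue_onI\<close>)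
  have "weakstar_Linf {a<..<b} g f"
    by (rule weakstar_LinfI[OF meas bound lim])
  then show "weakstar_Linf {a<..<b} (\<lambda>j. weak_deriv {a<..<b} (primitive a (g j))) (weak_deriv {a<..<b} (primitive a f))"
    by (simp add: weakstar_Linf_def wd[OF meas(1) bound(1)] wd[OF meas(2) bound(2)])
qed

section \<open>Oscillating functions\<close>

text \<open>
  The 1-periodic function that takes the value \<open>1 - l\<close> on a fraction \<open>l\<close> of each period and \<open>- l\<close> on
  the rest. Its mean is \<open>0\<close>, so adding a multiple of it to \<open>l * \<xi> + (1 - l) * \<eta>\<close> yields an oscillation between
  the values \<open>\<xi>\<close> and \<open>\<eta>\<close>.
\<close>
definition square_wave :: "real \<Rightarrow> real \<Rightarrow> real" where
  "square_wave l s = (if frac s < l then 1 - l else - l)"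

lemma square_wave_measurable[measurable]: "square_wave l \<in> borel_measurable borel"
  unfolding square_wave_def frac_def by measurable

lemma square_wave_bound:
  assumes "0 \<le> l" "l \<le> 1" shows "\<bar>square_wave l s\<bar> \<le> 1"
  using assms by (auto simp: square_wave_def)

lemma square_wave_has_integral_period:
  assumes "0 \<le> l" "l \<le> 1"
  shows "(square_wave l has_integral 0) {real k..real k + 1}"
proof -
  have fr: "frac x = x - real k" if "real k \<le> x" "x < real k + 1" for x
    using that by (subst frac_unique_iff) auto
  have "((\<lambda>_. 1 - l) has_integral measure lborel {real k..real k + l} *\<^sub>R (1 - l)) {real k..real k + l}"
    by (rule has_integral_const_real)
  then have 1: "(square_wave l has_integral l * (1 - l)) {real k..real k + l}"
    using assms by (intro has_integral_spike_finite[where S = "{real k + l}" and g = "square_wave l"])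
      (auto simp: square_wave_def fr)
  have "((\<lambda>_. - l) has_integral measure lborel {real k + l..real k + 1} *\<^sub>R (- l)) {real k + l..real k + 1}"
    by (rule has_integral_const_real)
  then have 2: "(square_wave l has_integral (1 - l) * (- l)) {real k + l..real k + 1}"
    using assms by (intro has_integral_spike_finite[where S = "{real k + 1}" and g = "square_wave l"])
      (auto simp: square_wave_def fr)
  show ?thesis
    using has_integral_combine[OF _ _ 1 2] assms by (simp add: algebra_simps)
qed

lemma square_wave_has_integral_periods:
  assumes "0 \<le> l" "l \<le> 1"
  shows "(square_wave l has_integral 0) {0..real n}"
proof (induction n)
  case (Suc n)
  then show ?case
    using has_integral_combine[OF _ _ Suc square_wave_has_integral_period[OF assms, of n]]
    by (simp add: add.commute)
qed auto

lemma square_wave_integrable: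
  assumes "0 \<le> l" "l \<le> 1" "0 \<le> s"
  shows "square_wave l integrable_on {s..t}"
proof -
  obtain n where "t \<le> real n" using real_arch_simple by blast
  then have "{s..t} \<subseteq> {0..real n}" using assms(3) by auto
  with has_integral_integrable[OF square_wave_has_integral_periods[OF assms(1,2)]]
  show ?thesis by (rule integrable_on_subinterval)
qed

lemma square_wave_integral_initial:
  assumes "0 \<le> l" "l \<le> 1" "0 \<le> t"
  shows "\<bar>integral {0..t} (square_wave l)\<bar> \<le> 1"
proof -
  define n where "n = nat \<lfloor>t\<rfloor>"
  have n: "real n \<le> t" "t < real n + 1"
    using assms(3) by (auto simp: n_def)
  have "integral {0..t} (square_wave l) =
      integral {0..real n} (square_wave l) + integral {real n..t} (square_wave l)"
    using n assms square_wave_integrable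
    by (subst Henstock_Kurzweil_Integration.integral_combine[where c = "real n"]) auto
  also have "\<dots> = integral {real n..t} (square_wave l)"
    using square_wave_has_integral_periods[OF assms(1,2), of n] by (simp add: integral_unique)
  finally have eq: "integral {0..t} (square_wave l) = integral {real n..t} (square_wave l)" .
  have "norm (integral {real n..t} (square_wave l)) \<le> 1 * measure lborel {real n..t}"
  proof (rule has_integral_bound_real)
    show "(square_wave l has_integral integral {real n..t} (square_wave l)) {real n..t}"
      using square_wave_integrable[OF assms(1,2)] by (intro integrable_integral) auto
  qed (use square_wave_bound[OF assms(1,2)] in auto)
  then show ?thesis using n eq by simp
qed

lemma square_wave_integral_bound:
  assumes l: "0 \<le> l" "l \<le> 1" and "0 \<le> s" "s \<le> t"
  shows "\<bar>LINT x|lborel. indicator {s<..<t} x * square_wave l x\<bar> \<le> 2"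
proof -
  have "set_integrable lborel {s<..<t} (square_wave l)"
    unfolding set_integrable_def
    by (rule integrableI_bounded_set_indicator[where B = 1])
      (use l square_wave_bound emeasure_bounded_finite[of "{s<..<t}"] in auto)
  then have "(LINT x|lborel. indicator {s<..<t} x * square_wave l x) = integral {s<..<t} (square_wave l)"
    using set_borel_integral_eq_integral(2)[of "{s<..<t}" "square_wave l"]
    by (simp add: set_lebesgue_integral_def)
  also have "\<dots> = integral {s..t} (square_wave l)"
    by (simp add: integral_open_interval_real)
  also have "\<dots> = integral {0..t} (square_wave l) - integral {0..s} (square_wave l)"
    using assms Henstock_Kurzweil_Integration.integral_combine[OF assms(3,4) square_wave_integrable[OF l order_refl]]
    by simp
  finally show ?thesis
    using square_wave_integral_initial[OF l, of s] square_wave_integral_initial[OF l, of t] assms(3,4)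
    by linarith
qed

text \<open>
  The integral of the wave over an interval is bounded independently of the length of the interval,
  so compressing the wave by the factor \<open>j\<close> makes it of order \<open>1 / j\<close>.
\<close>
lemma scaled_square_wave_integral_tendsto_zero:
  assumes l: "0 \<le> l" "l \<le> 1" and \<alpha>: "a \<le> \<alpha>" "\<alpha> \<le> \<beta>"
  shows "(\<lambda>j. LINT x|lborel. indicator {\<alpha><..<\<beta>} x * square_wave l (real (Suc j) * (x - a))) \<longlonglongrightarrow> 0"
proof (rule Lim_null_comparison)
  show "(\<lambda>j. 2 / real (Suc j)) \<longlonglongrightarrow> 0"
    using LIMSEQ_Suc[OF lim_const_over_n[of "2::real"]] by simp
  show "\<forall>\<^sub>F j in sequentially.
    norm (LINT x|lborel. indicator {\<alpha><..<\<beta>} x * square_wave l (real (Suc j) * (x - a))) \<le> 2 / real (Suc j)"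
  proof (rule always_eventually, rule allI)
    fix j :: nat
    define n where "n = real (Suc j)"
    have n: "n > 0" by (simp add: n_def)
    have "(LINT y|lborel. indicator {n * (\<alpha> - a)<..<n * (\<beta> - a)} y * square_wave l y) =
      \<bar>n\<bar> *\<^sub>R (LINT x|lborel. indicator {n * (\<alpha> - a)<..<n * (\<beta> - a)} (- n * a + n * x) * square_wave l (- n * a + n * x))"
      using n by (intro lborel_integral_real_affine) simp
    also have "(\<lambda>x. indicator {n * (\<alpha> - a)<..<n * (\<beta> - a)} (- n * a + n * x) * square_wave l (- n * a + n * x))
        = (\<lambda>x. indicator {\<alpha><..<\<beta>} x * square_wave l (n * (x - a)))"
    proof
      fix x
      have "- n * a + n * x = n * (x - a)" by (simp add: algebra_simps)
      then show "indicator {n * (\<alpha> - a)<..<n * (\<beta> - a)} (- n * a + n * x) * square_wave l (- n * a + n * x) =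
        indicator {\<alpha><..<\<beta>} x * square_wave l (n * (x - a))"
        using n by (auto split: split_indicator)
    qed
    finally have scale: "(LINT y|lborel. indicator {n * (\<alpha> - a)<..<n * (\<beta> - a)} y * square_wave l y) =
        \<bar>n\<bar> *\<^sub>R (LINT x|lborel. indicator {\<alpha><..<\<beta>} x * square_wave l (n * (x - a)))" .
    have "0 \<le> n * (\<alpha> - a)" "n * (\<alpha> - a) \<le> n * (\<beta> - a)"
      using n \<alpha> by (auto intro: mult_left_mono)
    from square_wave_integral_bound[OF l this]
    have "n * \<bar>LINT x|lborel. indicator {\<alpha><..<\<beta>} x * square_wave l (n * (x - a))\<bar> \<le> 2"
      unfolding scale using n by (simp only: real_scaleR_def abs_mult abs_abs abs_of_pos)
    then show "norm (LINT x|lborel. indicator {\<alpha><..<\<beta>} x * square_wave l (real (Suc j) * (x - a))) \<le> 2 / real (Suc j)"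
      unfolding n_def[symmetric] real_norm_def using n by (simp only: pos_le_divide_eq mult.commute)
  qed
qed

section \<open>Sublevel sets of the functional\<close>

lemma closed_sublevel:
  assumes "lower_semicontinuous V"
  shows "closed (sublevel V c)"
proof -
  have "open {p. V p > c}"
  proof (subst open_subopen, safe)
    fix p assume "c < V p"
    then have "ereal c < Liminf (at p) (\<lambda>q. ereal (V q))"
      using assms unfolding lower_semicontinuous_def by (metis less_ereal.simps(1) less_le_trans)
    then have "\<forall>\<^sub>F q in at p. c < V q"
      using less_LiminfD by fastforce
    then have "\<forall>\<^sub>F q in nhds p. c < V q"
      using \<open>c < V p\<close> by (auto simp: eventually_at_filter elim: eventually_mono)
    then show "\<exists>T. open T \<and> p \<in> T \<and> T \<subseteq> {p. V p > c}"
      by (auto simp: eventually_nhds)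
  qed
  moreover have "sublevel V c = - {p. V p > c}" by (auto simp: sublevel_def)
  ultimately show ?thesis by (simp add: closed_def)
qed

lemma lower_semicontinuous_borel:
  assumes "lower_semicontinuous V"
  shows "V \<in> borel_measurable borel"
  unfolding borel_measurable_iff_le
  using borel_closed[OF closed_sublevel[OF assms]] by (simp add: sublevel_def)

lemma AE_lborel_pairI:
  fixes P :: "real \<Rightarrow> bool"
  assumes "AE x in lborel. P x"
  shows "AE p in lborel. P (fst p) \<and> P (snd p)"
proof -
  obtain N where N: "\<And>x. x \<notin> N \<Longrightarrow> P x" "N \<in> null_sets lborel"
    using AE_E3[OF assms] by auto
  then have [measurable]: "N \<in> sets borel" by auto
  have notin: "AE x in lborel. x \<notin> N" by (rule AE_not_in[OF N(2)])
  have "AE p in lborel \<Otimes>\<^sub>M lborel. fst p \<notin> N \<and> snd p \<notin> N"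
  proof (rule lborel_pair.AE_pair_measure)
    show "{p \<in> space (lborel \<Otimes>\<^sub>M lborel). fst p \<notin> N \<and> snd p \<notin> N} \<in> sets (lborel \<Otimes>\<^sub>M lborel)"
      by measurable
    show "AE x in lborel. AE y in lborel. fst (x, y) \<notin> N \<and> snd (x, y) \<notin> N"
      using notin by eventually_elim (use notin in auto)
  qed
  then show ?thesis
    unfolding lborel_prod by eventually_elim (use N(1) in auto)
qed

text \<open>
  The inequality \<open>J1d V I u \<le> c\<close> becomes the statement that almost all pairs of values of the
  derivative lie in the sublevel set. The iterated form allows one variable to be treated at a time, and
  any Borel representative \<open>g\<close> of the derivative may be used. As the essential supremum of a
  non-measurable function is infinite by definition, measurability has to be established; it comes from
  \<open>g\<close> by completeness of Lebesgue measure.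
\<close>
lemma J1d_le_iff:
  assumes lsc: "lower_semicontinuous V"
    and g[measurable]: "g \<in> borel_measurable borel"
    and ae: "AE x in lebesgue_on {a<..<b}. weak_deriv {a<..<b} u x = g x"
  shows "J1d V {a<..<b} u \<le> ereal c \<longleftrightarrow>
    (AE x in lebesgue_on {a<..<b}. AE y in lebesgue_on {a<..<b}. (g x, g y) \<in> sublevel V c)"
proof -
  let ?I = "{a<..<b}"
  let ?w = "weak_deriv ?I u"
  have [measurable]: "V \<in> borel_measurable borel" by (rule lower_semicontinuous_borel[OF lsc])
  have II: "?I \<times> ?I \<in> sets borel" by (intro borel_open open_Times) auto
  have eq: "AE p in lborel. p \<in> ?I \<times> ?I \<longrightarrow> ?w (fst p) = g (fst p) \<and> ?w (snd p) = g (snd p)"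
    using AE_lborel_pairI[OF ae[unfolded AE_lebesgue_on_iff[OF borel_open[OF open_greaterThanLessThan]]]]
    by eventually_elim auto
  have Gm: "(\<lambda>p. V (g (fst p), g (snd p))) \<in> borel_measurable borel"
  proof -
    have "(\<lambda>p. (g (fst p), g (snd p))) \<in> borel \<Otimes>\<^sub>M borel \<rightarrow>\<^sub>M borel \<Otimes>\<^sub>M borel"
      by measurable
    then show ?thesis
      unfolding borel_prod by (rule measurable_compose) (rule lower_semicontinuous_borel[OF lsc])
  qed
  have Wm: "(\<lambda>(x, y). ereal (V (?w x, ?w y))) \<in> borel_measurable (lebesgue_on (?I \<times> ?I))"
  proof -
    let ?f = "\<lambda>p. if p \<in> ?I \<times> ?I then V (g (fst p), g (snd p)) else 0"
    let ?h = "\<lambda>p. if p \<in> ?I \<times> ?I then V (?w (fst p), ?w (snd p)) else 0"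
    have "?f \<in> borel_measurable borel"
      by (rule measurable_If_set[OF Gm]) (use II in auto)
    then have "?f \<in> borel_measurable lebesgue" by (intro measurable_completion) simp
    moreover have "AE p in lebesgue. ?f p = ?h p"
      unfolding AE_completion_iff using eq by eventually_elim auto
    ultimately have "?h \<in> borel_measurable lebesgue"
      by (rule borel_measurable_AE)
    then have "(\<lambda>p. V (?w (fst p), ?w (snd p))) \<in> borel_measurable (lebesgue_on (?I \<times> ?I))"
      by (rule borel_measurable_if_D)
    then show ?thesis by (simp add: case_prod_unfold)
  qed
  have "J1d V ?I u \<le> ereal c \<longleftrightarrow> (AE p in lebesgue_on (?I \<times> ?I). V (?w (fst p), ?w (snd p)) \<le> c)"
  proof
    assume "J1d V ?I u \<le> ereal c"
    then have le: "esssup (lebesgue_on (?I \<times> ?I)) (\<lambda>(x, y). ereal (V (?w x, ?w y))) \<le> ereal c"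
      unfolding J1d_def .
    have "AE p in lebesgue_on (?I \<times> ?I). (\<lambda>(x, y). ereal (V (?w x, ?w y))) p \<le> ereal c"
      using esssup_AE by eventually_elim (rule order_trans[OF _ le])
    then show "AE p in lebesgue_on (?I \<times> ?I). V (?w (fst p), ?w (snd p)) \<le> c"
      by (simp add: case_prod_unfold)
  next
    assume "AE p in lebesgue_on (?I \<times> ?I). V (?w (fst p), ?w (snd p)) \<le> c"
    then show "J1d V ?I u \<le> ereal c"
      unfolding J1d_def by (intro esssup_I[OF Wm]) (simp add: case_prod_unfold)
  qed
  also have "\<dots> \<longleftrightarrow> (AE p in lborel. p \<in> ?I \<times> ?I \<longrightarrow> V (?w (fst p), ?w (snd p)) \<le> c)"
    by (rule AE_lebesgue_on_iff[OF II])
  also have "\<dots> \<longleftrightarrow> (AE p in lborel. p \<in> ?I \<times> ?I \<longrightarrow> V (g (fst p), g (snd p)) \<le> c)"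
    by (rule eventually_cong[OF eq]) auto
  also have "\<dots> \<longleftrightarrow> (AE p in lborel \<Otimes>\<^sub>M lborel. fst p \<in> ?I \<longrightarrow> snd p \<in> ?I \<longrightarrow> V (g (fst p), g (snd p)) \<le> c)"
    unfolding lborel_prod by (auto simp: mem_Times_iff intro!: arg_cong2[where f = eventually])
  also have "\<dots> \<longleftrightarrow> (AE x in lborel. AE y in lborel. x \<in> ?I \<longrightarrow> y \<in> ?I \<longrightarrow> V (g x, g y) \<le> c)"
    by (rule lborel_pair.AE_pair_iff[symmetric]) measurable
  also have "\<dots> \<longleftrightarrow> (AE x in lebesgue_on ?I. AE y in lebesgue_on ?I. (g x, g y) \<in> sublevel V c)"
    by (auto simp: AE_lebesgue_on_iff sublevel_def)
  finally show ?thesis .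
qed

section \<open>Separate convexity and weak* limits\<close>

text \<open>
  If the average were not in \<open>C\<close>, then \<open>C\<close> would lie on one side of it, and a function whose values
  differ from a number and lie on one side of it does not have this number as average.
\<close>
lemma (in finite_measure) average_mem_convex:
  fixes f :: "'a \<Rightarrow> real"
  assumes C: "convex C" and f: "integrable M f" and A: "A \<in> sets M" "measure M A > 0"
    and fC: "AE x in M. x \<in> A \<longrightarrow> f x \<in> C"
  shows "(\<integral>x. f x * indicator A x \<partial>M) / measure M A \<in> C" (is "?m \<in> C")
proof (rule ccontr)
  assume m: "?m \<notin> C"
  have intf: "integrable M (\<lambda>x. f x * indicator A x)"
    using integrable_mult_indicator[OF A(1) f] by (simp add: mult.commute)
  have intm: "integrable M (\<lambda>x. ?m * indicator A x)"
    using A by (intro integrable_mult_right integrable_real_indicator) (auto simp: less_top[symmetric])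
  have mean: "(\<integral>x. ?m * indicator A x \<partial>M) = (\<integral>x. f x * indicator A x \<partial>M)"
    using A by simp
  have A0: "emeasure M A \<noteq> 0" using A by (auto simp: emeasure_eq_measure)
  have ne: "AE x in M. x \<in> A \<longrightarrow> f x * indicator A x \<noteq> ?m * indicator A x"
    using fC m by (auto elim: eventually_mono)
  have "(\<forall>c\<in>C. c \<le> ?m) \<or> (\<forall>c\<in>C. ?m \<le> c)"
  proof (rule ccontr)
    assume "\<not> ?thesis"
    then obtain c d where "c \<in> C" "d \<in> C" "c < ?m" "?m < d" by (auto simp: not_le)
    then show False using C m
      unfolding is_interval_convex_1[symmetric] is_interval_1 by (meson less_imp_le)
  qed
  then show False
  proof
    assume "\<forall>c\<in>C. c \<le> ?m"
    then have "AE x in M. f x * indicator A x \<le> ?m * indicator A x"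
      using fC by (auto elim!: eventually_mono split: split_indicator)
    from integral_less_AE[OF intf intm A0 A(1) ne this] mean show False by simp
  next
    assume "\<forall>c\<in>C. ?m \<le> c"
    then have "AE x in M. ?m * indicator A x \<le> f x * indicator A x"
      using fC by (auto elim!: eventually_mono split: split_indicator)
    moreover have "AE x in M. x \<in> A \<longrightarrow> ?m * indicator A x \<noteq> f x * indicator A x"
      using ne by (auto elim: eventually_mono)
    ultimately show False
      using integral_less_AE[OF intm intf A0 A(1)] mean by simp
  qed
qed

lemma separately_convex_slices:
  assumes "separately_convex K"
  shows "convex {\<eta>. (\<xi>, \<eta>) \<in> K}" "convex {\<xi>. (\<xi>, \<eta>) \<in> K}"
proof -
  have gen: "convex S"
    if S: "\<And>x y t. x \<in> S \<Longrightarrow> y \<in> S \<Longrightarrow> 0 < t \<Longrightarrow> t < 1 \<Longrightarrow> t * x + (1 - t) * y \<in> S" for S :: "real set"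
  proof (rule convexI)
    fix x y u v :: real
    assume "x \<in> S" "y \<in> S" "0 \<le> u" "0 \<le> v" "u + v = 1"
    moreover from this have "v = 1 - u" by simp
    ultimately show "u *\<^sub>R x + v *\<^sub>R y \<in> S"
      using S[of x y u] by (cases "u = 0 \<or> u = 1") auto
  qed
  have K: "(t * \<xi>1 + (1 - t) * \<eta>1, t * \<xi>2 + (1 - t) * \<eta>2) \<in> K"
    if "(\<xi>1, \<xi>2) \<in> K" "(\<eta>1, \<eta>2) \<in> K" "\<xi>1 = \<eta>1 \<or> \<xi>2 = \<eta>2" "0 < t" "t < 1" for \<xi>1 \<xi>2 \<eta>1 \<eta>2 t
    using assms that unfolding separately_convex_def by fastforce
  show "convex {\<eta>. (\<xi>, \<eta>) \<in> K}"
    using K[of \<xi> _ \<xi>] by (intro gen) (auto simp: algebra_simps)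
  show "convex {\<xi>. (\<xi>, \<eta>) \<in> K}"
    using K[of _ \<eta> _ \<eta>] by (intro gen) (auto simp: algebra_simps)
qed

text \<open>
  Averaging in one variable at a time uses only convexity of the slices.
\<close>
lemma (in finite_measure) averages_mem_separately_convex:
  fixes f :: "'a \<Rightarrow> real"
  assumes K: "separately_convex K" and f: "integrable M f"
    and A: "A \<in> sets M" "measure M A > 0" and B: "B \<in> sets M" "measure M B > 0"
    and mem: "AE x in M. AE y in M. (f x, f y) \<in> K"
  shows "((\<integral>x. f x * indicator A x \<partial>M) / measure M A, (\<integral>x. f x * indicator B x \<partial>M) / measure M B) \<in> K"
    (is "(?p, ?q) \<in> K")
proof -
  have "AE x in M. (f x, ?q) \<in> K"
    using mem
  proof eventually_elim
    case (elim x)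
    have "?q \<in> {\<eta>. (f x, \<eta>) \<in> K}"
      by (rule average_mem_convex[OF separately_convex_slices(1)[OF K] f B])
        (use elim in \<open>auto elim: eventually_mono\<close>)
    then show ?case by simp
  qed
  then have "?p \<in> {\<xi>. (\<xi>, ?q) \<in> K}"
    by (intro average_mem_convex[OF separately_convex_slices(2)[OF K] f A])
      (auto elim: eventually_mono)
  then show ?thesis by simp
qed

lemma open_box_decomposition_plane:
  fixes S :: "(real \<times> real) set"
  assumes "open S"
  obtains \<D> where "countable \<D>" "\<And>U W. (U, W) \<in> \<D> \<Longrightarrow> open U \<and> open W \<and> convex U \<and> convex W"
    "(\<Union>(U, W)\<in>\<D>. U \<times> W) = S"
proof -
  obtain \<B> where \<B>: "countable \<B>" "\<B> \<subseteq> Pow S" "\<And>X. X \<in> \<B> \<Longrightarrow> \<exists>a b. X = box a b" "\<Union>\<B> = S"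
    using open_countable_Union_open_box[OF assms] by metis
  have prod: "X = fst ` X \<times> snd ` X" "open (fst ` X)" "open (snd ` X)" "convex (fst ` X)" "convex (snd ` X)"
    if XB: "X \<in> \<B>" for X
  proof -
    obtain a b where X: "X = box a b" using \<B>(3)[OF XB] by blast
    show "X = fst ` X \<times> snd ` X"
      unfolding X by (force simp: mem_box Basis_prod_def inner_prod_def image_iff)
    show "open (fst ` X)" "open (snd ` X)"
      unfolding X by (auto intro: open_image_fst open_image_snd)
    show "convex (fst ` X)" "convex (snd ` X)"
      unfolding X by (intro convex_linear_image linear_fst linear_snd convex_box)+
  qed
  show ?thesis
  proof (rule that[of "(\<lambda>X. (fst ` X, snd ` X)) ` \<B>"])
    show "(\<Union>(U, W)\<in>(\<lambda>X. (fst ` X, snd ` X)) ` \<B>. U \<times> W) = S"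
    proof -
      have "(\<Union>X\<in>\<B>. fst ` X \<times> snd ` X) = (\<Union>X\<in>\<B>. X)"
        by (intro SUP_cong refl prod(1)[symmetric])
      then show ?thesis using \<B>(4) by simp
    qed
  qed (use \<B>(1) prod(2-5) in auto)
qed

text \<open>
  Weak* convergence is convergence of all averages. If an open box \<open>U \<times> W\<close> outside \<open>K\<close> were hit by
  \<open>(g x, g y)\<close> on a set of positive measure, then so would be \<open>U\<close> by \<open>g x\<close> and \<open>W\<close> by \<open>g y\<close>; the averages
  of \<open>g\<close> over these two preimages form a point of \<open>U \<times> W\<close>, and so do eventually those of \<open>f j\<close>, although
  the latter form a point of \<open>K\<close> for infinitely many \<open>j\<close>. The complement of \<open>K\<close> is a countable union of such boxes.
\<close>
lemma separately_convex_weakstar_closed: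
  assumes K: "closed K" "separately_convex K"
    and f: "\<And>j. f j \<in> Linf {a<..<b}" and g: "g \<in> Linf {a<..<b}"
    and lim: "weakstar_Linf {a<..<b} f g"
    and freq: "\<exists>\<^sub>F j in sequentially.
      AE x in lebesgue_on {a<..<b}. AE y in lebesgue_on {a<..<b}. (f j x, f j y) \<in> K"
  shows "AE x in lebesgue_on {a<..<b}. AE y in lebesgue_on {a<..<b}. (g x, g y) \<in> K"
proof -
  let ?M = "lebesgue_on {a<..<b}"
  interpret finite_measure ?M
    by (rule finite_measureI) (use emeasure_bounded_finite[of "{a<..<b}"] in \<open>simp add: emeasure_restrict_space\<close>)
  have int: "integrable ?M h" if hL: "h \<in> Linf {a<..<b}" for h
  proof -
    obtain C where "h \<in> borel_measurable ?M" "AE x in ?M. norm (h x) \<le> C"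
      using hL unfolding Linf_def real_norm_def by blast
    then show ?thesis by (intro integrable_const_bound)
  qed
  have [measurable]: "g \<in> borel_measurable ?M" using g by (simp add: Linf_def)
  have level_set: "g -` U \<inter> space ?M \<in> sets ?M" if "open U" for U
    using that by (intro measurable_sets[where A = borel]) auto
  have average_lim: "\<forall>\<^sub>F j in sequentially. (\<integral>x. f j x * indicator A x \<partial>?M) / measure ?M A \<in> U"
    if "A \<in> sets ?M" "measure ?M A > 0" "open U" "convex U" "\<And>x. x \<in> A \<Longrightarrow> g x \<in> U" for A U
  proof -
    have "integrable ?M (indicator A :: real \<Rightarrow> real)"
      using that(1) by (intro integrable_real_indicator) (auto simp: less_top[symmetric])
    then have "(\<lambda>j. (\<integral>x. f j x * indicator A x \<partial>?M) / measure ?M A) \<longlonglongrightarrow>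
        (\<integral>x. g x * indicator A x \<partial>?M) / measure ?M A"
      using lim that(2) by (intro tendsto_divide) (auto simp: weakstar_Linf_def)
    moreover have "(\<integral>x. g x * indicator A x \<partial>?M) / measure ?M A \<in> U"
      by (rule average_mem_convex[OF that(4) int[OF g] that(1,2)]) (use that(5) in auto)
    ultimately show ?thesis by (rule topological_tendstoD[OF _ that(3)])
  qed
  have avoid: "AE x in ?M. AE y in ?M. \<not> (g x \<in> U \<and> g y \<in> W)"
    if U: "open U" "convex U" and W: "open W" "convex W" and UW: "U \<times> W \<subseteq> - K" for U W
  proof -
    let ?A = "g -` U \<inter> space ?M" and ?B = "g -` W \<inter> space ?M"
    have null: "AE x in ?M. x \<notin> A" if "A \<in> sets ?M" "\<not> measure ?M A > 0" for A
      using that by (intro AE_not_in) (auto simp: null_sets_def emeasure_eq_measure zero_less_measure_iff)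
    have "\<not> (measure ?M ?A > 0 \<and> measure ?M ?B > 0)"
    proof
      assume pos: "measure ?M ?A > 0 \<and> measure ?M ?B > 0"
      have "\<forall>\<^sub>F j in sequentially.
          (\<integral>x. f j x * indicator ?A x \<partial>?M) / measure ?M ?A \<in> U \<and>
          (\<integral>x. f j x * indicator ?B x \<partial>?M) / measure ?M ?B \<in> W"
        using pos U W by (intro eventually_conj average_lim level_set) auto
      with freq obtain j where
        j: "AE x in ?M. AE y in ?M. (f j x, f j y) \<in> K"
        and "(\<integral>x. f j x * indicator ?A x \<partial>?M) / measure ?M ?A \<in> U"
          "(\<integral>x. f j x * indicator ?B x \<partial>?M) / measure ?M ?B \<in> W"
        using frequently_ex[OF frequently_eventually_conj] by blast
      moreover have "((\<integral>x. f j x * indicator ?A x \<partial>?M) / measure ?M ?A,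
          (\<integral>x. f j x * indicator ?B x \<partial>?M) / measure ?M ?B) \<in> K"
        using pos level_set[OF U(1)] level_set[OF W(1)]
        by (intro averages_mem_separately_convex[OF K(2) int[OF f] _ _ _ _ j]) auto
      ultimately show False using UW by blast
    qed
    then consider "\<not> measure ?M ?A > 0" | "\<not> measure ?M ?B > 0" by blast
    then show ?thesis
    proof cases
      case 1
      with null[OF level_set[OF U(1)]] have "AE x in ?M. x \<notin> ?A" by blast
      then show ?thesis
        using AE_space by eventually_elim auto
    next
      case 2
      with null[OF level_set[OF W(1)]] have "AE x in ?M. x \<notin> ?B" by blast
      then have "AE y in ?M. g y \<notin> W"
        using AE_space by eventually_elim auto
      then have "AE y in ?M. \<not> (g x \<in> U \<and> g y \<in> W)" for x
        by eventually_elim simp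
      then show ?thesis by simp
    qed
  qed
  obtain \<D> where \<D>: "countable \<D>" "\<And>U W. (U, W) \<in> \<D> \<Longrightarrow> open U \<and> open W \<and> convex U \<and> convex W"
    "(\<Union>(U, W)\<in>\<D>. U \<times> W) = - K"
    using open_box_decomposition_plane[of "- K"] K(1) by (auto simp: closed_def)
  have "AE x in ?M. \<forall>D\<in>\<D>. AE y in ?M. \<not> (g x \<in> fst D \<and> g y \<in> snd D)"
  proof (subst AE_ball_countable[OF \<D>(1)], safe)
    fix U W assume D: "(U, W) \<in> \<D>"
    then have "U \<times> W \<subseteq> - K" using \<D>(3) by blast
    then show "AE x in ?M. AE y in ?M. \<not> (g x \<in> fst (U, W) \<and> g y \<in> snd (U, W))"
      unfolding fst_conv snd_conv by (rule avoid[rotated -1]) (use \<D>(2)[OF D] in auto)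
  qed
  then show ?thesis
  proof eventually_elim
    case (elim x)
    then have "AE y in ?M. \<forall>D\<in>\<D>. \<not> (g x \<in> fst D \<and> g y \<in> snd D)"
      by (simp add: AE_ball_countable[OF \<D>(1)])
    then show ?case
    proof eventually_elim
      case (elim y)
      then have "(g x, g y) \<notin> (\<Union>(U, W)\<in>\<D>. U \<times> W)" by auto
      then show ?case using \<D>(3) by simp
    qed
  qed
qed

lemma lsc_if_separately_level_convex:
  assumes lsc: "lower_semicontinuous V" and conv: "separately_level_convex V"
  shows "weakstar_seq_lsc {a<..<b} (J1d V {a<..<b})"
  unfolding weakstar_seq_lsc_def
proof (intro allI impI)
  fix U u
  assume U: "\<forall>j. U j \<in> W1inf {a<..<b}" and u: "u \<in> W1inf {a<..<b}"
    and lim: "weakstar_W1inf {a<..<b} U u"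
  let ?M = "lebesgue_on {a<..<b}"
  let ?w = "weak_deriv {a<..<b}"
  have J_iff: "J1d V {a<..<b} v \<le> ereal c \<longleftrightarrow> (AE x in ?M. AE y in ?M. (?w v x, ?w v y) \<in> sublevel V c)"
    if v: "v \<in> W1inf {a<..<b}" for v c
  proof -
    obtain g where g: "g \<in> borel_measurable borel" "AE x in ?M. ?w v x = g x"
      using Linf_representative[OF weak_deriv_W1inf(1)[OF v]] by metis
    have "J1d V {a<..<b} v \<le> ereal c \<longleftrightarrow> (AE x in ?M. AE y in ?M. (g x, g y) \<in> sublevel V c)"
      by (rule J1d_le_iff[OF lsc g])
    also have "\<dots> \<longleftrightarrow> (AE x in ?M. AE y in ?M. (?w v x, ?w v y) \<in> sublevel V c)"
    proof (rule eventually_cong[OF g(2)])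
      fix x assume "?w v x = g x"
      show "(AE y in ?M. (g x, g y) \<in> sublevel V c) = (AE y in ?M. (?w v x, ?w v y) \<in> sublevel V c)"
        by (rule eventually_cong[OF g(2)]) (simp add: \<open>?w v x = g x\<close>)
    qed
    finally show ?thesis .
  qed
  show "J1d V {a<..<b} u \<le> liminf (\<lambda>j. J1d V {a<..<b} (U j))"
    unfolding le_Liminf_iff
  proof (intro allI impI, rule ccontr)
    fix y assume y: "y < J1d V {a<..<b} u"
      and "\<not> (\<forall>\<^sub>F j in sequentially. y < J1d V {a<..<b} (U j))"
    then have freq: "\<exists>\<^sub>F j in sequentially. J1d V {a<..<b} (U j) \<le> y"
      by (simp add: frequently_def not_le)
    obtain c where c: "y < ereal c" "ereal c < J1d V {a<..<b} u"
      using ereal_dense2[OF y] by blast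
    have "\<exists>\<^sub>F j in sequentially. AE x in ?M. AE y in ?M. (?w (U j) x, ?w (U j) y) \<in> sublevel V c"
      using freq
    proof (rule frequently_elim1)
      fix j assume "J1d V {a<..<b} (U j) \<le> y"
      then have "J1d V {a<..<b} (U j) \<le> ereal c" using c(1) by simp
      then show "AE x in ?M. AE y in ?M. (?w (U j) x, ?w (U j) y) \<in> sublevel V c"
        using J_iff U by blast
    qed
    then have "AE x in ?M. AE y in ?M. (?w u x, ?w u y) \<in> sublevel V c"
      using conv lim U u weak_deriv_W1inf(1)
      by (intro separately_convex_weakstar_closed[where f = "\<lambda>j. ?w (U j)"] closed_sublevel[OF lsc])
        (auto simp: separately_level_convex_def weakstar_W1inf_def)
    then have "J1d V {a<..<b} u \<le> ereal c" using J_iff[OF u] by blast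
    with c(2) show False by simp
  qed
qed

section \<open>Necessity of separate convexity\<close>

text \<open>
  The test sequence: on the left half of the interval the derivatives oscillate between \<open>\<xi>\<close> and \<open>\<eta>\<close>
  and converge weakly* to \<open>l * \<xi> + (1 - l) * \<eta>\<close>, on the right half they equal \<open>\<eta>\<close>. As \<open>V\<close> is diagonal and
  symmetric, \<open>{\<xi>, \<eta>} \<times> {\<xi>, \<eta>}\<close> is contained in the sublevel set, so the functional is at most \<open>c\<close> along the
  sequence. Lower semicontinuity and the pairs with \<open>x\<close> in the left and \<open>y\<close> in the right half
  give the claim.
\<close>

lemma segment_mem_sublevel_if_lsc:
  assumes "a < b" and lsc: "lower_semicontinuous V" and diag: "diagonal V" and sym: "symmetric V"
    and J: "weakstar_seq_lsc {a<..<b} (J1d V {a<..<b})"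
    and K: "(\<xi>, \<eta>) \<in> sublevel V c"
    and l: "0 \<le> l" "l \<le> 1"
  shows "(l * \<xi> + (1 - l) * \<eta>, \<eta>) \<in> sublevel V c"
proof -
  let ?M = "lebesgue_on {a<..<b}"
  define m where "m = (a + b) / 2"
  have m: "a < m" "m < b" using \<open>a < b\<close> by (auto simp: m_def)
  define \<zeta> where "\<zeta> = l * \<xi> + (1 - l) * \<eta>"
  \<comment> \<open>On the interval the argument of the wave is nonnegative, where the bound on its integrals holds.\<close>
  define g where "g j x = (if x < m then \<zeta> + (\<xi> - \<eta>) * square_wave l (real (Suc j) * (x - a)) else \<eta>)" for j x
  define f where "f x = (if x < m then \<zeta> else \<eta>)" for x
  define C where "C = \<bar>\<xi>\<bar> + \<bar>\<eta>\<bar> + \<bar>\<zeta>\<bar>"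
  have g_values: "g j x = \<xi> \<or> g j x = \<eta>" for j x
    by (auto simp: g_def square_wave_def \<zeta>_def algebra_simps)
  have meas: "g j \<in> borel_measurable borel" "f \<in> borel_measurable borel" for j
    unfolding g_def f_def by measurable
  have bound: "\<bar>g j x\<bar> \<le> C" "\<bar>f x\<bar> \<le> C" for j x
    using g_values[of j x] by (auto simp: C_def f_def)
  have lim: "(\<lambda>j. LINT x|lborel. indicator {\<alpha><..<\<beta>} x * (g j x - f x)) \<longlonglongrightarrow> 0"
    if "a \<le> \<alpha>" "\<alpha> \<le> \<beta>" "\<beta> \<le> b" for \<alpha> \<beta>
  proof -
    let ?\<alpha> = "min \<alpha> m" and ?\<beta> = "min \<beta> m"
    have "(LINT x|lborel. indicator {\<alpha><..<\<beta>} x * (g j x - f x)) =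
        (\<xi> - \<eta>) * (LINT x|lborel. indicator {?\<alpha><..<?\<beta>} x * square_wave l (real (Suc j) * (x - a)))" for j
    proof -
      have "(LINT x|lborel. indicator {\<alpha><..<\<beta>} x * (g j x - f x)) =
          (LINT x|lborel. (\<xi> - \<eta>) * (indicator {?\<alpha><..<?\<beta>} x * square_wave l (real (Suc j) * (x - a))))"
        by (rule Bochner_Integration.integral_cong[OF refl])
          (auto simp: g_def f_def indicator_def min_def simp del: of_nat_Suc)
      then show ?thesis by simp
    qed
    moreover have "(\<lambda>j. (\<xi> - \<eta>) * (LINT x|lborel. indicator {?\<alpha><..<?\<beta>} x * square_wave l (real (Suc j) * (x - a)))) \<longlonglongrightarrow> 0"
      using that m by (intro tendsto_mult_right_zero scaled_square_wave_integral_tendsto_zero l) auto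
    ultimately show ?thesis by simp
  qed
  have K': "(p, q) \<in> sublevel V c" if "p \<in> {\<xi>, \<eta>}" "q \<in> {\<xi>, \<eta>}" for p q
    using K diag sym that unfolding diagonal_def symmetric_def by (auto simp: sublevel_def)
  have "J1d V {a<..<b} (primitive a (g j)) \<le> ereal c" for j
    unfolding J1d_le_iff[OF lsc meas(1) weak_deriv_primitive[OF meas(1) bound(1)]]
    by (intro always_eventually allI K') (use g_values in auto)
  then have "liminf (\<lambda>j. J1d V {a<..<b} (primitive a (g j))) \<le> ereal c"
    by (intro Liminf_le always_eventually allI) simp_all
  moreover have "J1d V {a<..<b} (primitive a f) \<le> liminf (\<lambda>j. J1d V {a<..<b} (primitive a (g j)))"
  proof (rule J[unfolded weakstar_seq_lsc_def, rule_format])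
    show "primitive a (g j) \<in> W1inf {a<..<b}" for j by (rule primitive_W1inf[OF meas(1) bound(1)])
    show "primitive a f \<in> W1inf {a<..<b}" by (rule primitive_W1inf[OF meas(2) bound(2)])
    show "weakstar_W1inf {a<..<b} (\<lambda>j. primitive a (g j)) (primitive a f)"
      by (rule weakstar_primitive[OF meas bound lim])
  qed
  ultimately have "J1d V {a<..<b} (primitive a f) \<le> ereal c" by (rule order_trans[rotated])
  then have "AE x in ?M. AE y in ?M. (f x, f y) \<in> sublevel V c"
    unfolding J1d_le_iff[OF lsc meas(2) weak_deriv_primitive[OF meas(2) bound(2)]] .
  moreover have pos: "\<exists>x\<in>{c<..<d}. P x"
    if "a \<le> c" "c < d" "d \<le> b" "AE x in ?M. P x" for c d P
  proof (rule ccontr)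
    assume "\<not> ?thesis"
    moreover have "AE x in lborel. x \<in> {a<..<b} \<longrightarrow> P x"
      using that(4) by (simp add: AE_lebesgue_on_iff)
    ultimately have "AE x in lborel. x \<notin> {c<..<d}"
      using that(1-3) by (auto elim!: eventually_mono)
    then have "emeasure lborel {c<..<d} = 0"
      by (subst (asm) AE_iff_measurable[where N = "{c<..<d}"]) auto
    then show False using that(2) by simp
  qed
  ultimately obtain x where x: "x \<in> {a<..<m}" "AE y in ?M. (f x, f y) \<in> sublevel V c"
    using pos[of a m] m by force
  obtain y where "y \<in> {m<..<b}" "(f x, f y) \<in> sublevel V c"
    using pos[OF _ _ _ x(2), of m b] m by force
  with x(1) show ?thesis by (simp add: f_def \<zeta>_def)
qed

text \<open>
  Let \<open>\<zeta>\<close> lie between \<open>\<eta>1\<close> and \<open>\<eta>2\<close>, where \<open>(\<eta>1, \<xi>)\<close> and \<open>(\<eta>2, \<xi>)\<close> are in \<open>K\<close>. On the real line,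
  \<open>\<zeta>\<close> then lies between \<open>\<eta>1\<close> and \<open>\<xi>\<close> or between \<open>\<eta>2\<close> and \<open>\<xi>\<close>. So it suffices to move the first
  coordinate towards the second one.
\<close>

lemma separately_convexI_symmetric:
  assumes sym: "\<And>\<xi> \<eta>. (\<xi>, \<eta>) \<in> K \<Longrightarrow> (\<eta>, \<xi>) \<in> K"
    and seg: "\<And>\<xi> \<eta> l. (\<xi>, \<eta>) \<in> K \<Longrightarrow> 0 \<le> l \<Longrightarrow> l \<le> 1 \<Longrightarrow> (l * \<xi> + (1 - l) * \<eta>, \<eta>) \<in> K"
  shows "separately_convex K"
proof -
  have seg': "(\<zeta>, \<eta>) \<in> K" if mem: "(\<xi>, \<eta>) \<in> K" and \<zeta>: "\<zeta> \<in> closed_segment \<xi> \<eta>" for \<xi> \<eta> \<zeta>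
  proof -
    obtain u where "\<zeta> = (1 - u) * \<xi> + u * \<eta>" "0 \<le> u" "u \<le> 1"
      using \<zeta> by (auto simp: in_segment)
    then show ?thesis using seg[OF mem, of "1 - u"] by simp
  qed
  have comb: "(t * \<eta>1 + (1 - t) * \<eta>2, \<xi>) \<in> K"
    if mem: "(\<eta>1, \<xi>) \<in> K" "(\<eta>2, \<xi>) \<in> K" and t: "0 < t" "t < 1" for \<xi> \<eta>1 \<eta>2 t
  proof -
    have "t * \<eta>1 + (1 - t) * \<eta>2 \<in> closed_segment \<eta>1 \<eta>2"
      unfolding in_segment using t by (intro exI[of _ "1 - t"]) auto
    then have "t * \<eta>1 + (1 - t) * \<eta>2 \<in> closed_segment \<eta>1 \<xi> \<or> t * \<eta>1 + (1 - t) * \<eta>2 \<in> closed_segment \<eta>2 \<xi>"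
      by (simp add: closed_segment_eq_real_ivl split: if_splits) linarith+
    then show ?thesis
      using seg' mem by blast
  qed
  show ?thesis
    unfolding separately_convex_def
  proof (intro allI impI ballI)
    fix \<xi>1 \<xi>2 \<eta>1 \<eta>2 t :: real
    assume mem: "(\<xi>1, \<xi>2) \<in> K" "(\<eta>1, \<eta>2) \<in> K" and eq: "\<xi>1 = \<eta>1 \<or> \<xi>2 = \<eta>2"
      and t: "t \<in> {0<..<1}"
    have avg: "t * z + (1 - t) * z = z" for z :: real by (simp add: algebra_simps)
    show "t *\<^sub>R (\<xi>1, \<xi>2) + (1 - t) *\<^sub>R (\<eta>1, \<eta>2) \<in> K"
      using eq
    proof
      assume "\<xi>1 = \<eta>1"
      have "(t * \<xi>2 + (1 - t) * \<eta>2, \<xi>1) \<in> K"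
        by (rule comb) (use mem t \<open>\<xi>1 = \<eta>1\<close> in \<open>auto intro: sym\<close>)
      from sym[OF this] show ?thesis
        by (simp add: avg flip: \<open>\<xi>1 = \<eta>1\<close>)
    next
      assume "\<xi>2 = \<eta>2"
      have "(t * \<xi>1 + (1 - t) * \<eta>1, \<xi>2) \<in> K"
        by (rule comb) (use mem t \<open>\<xi>2 = \<eta>2\<close> in auto)
      then show ?thesis
        by (simp add: avg flip: \<open>\<xi>2 = \<eta>2\<close>)
    qed
  qed
qed


section \<open>Characterization of lower semicontinuity\<close>

theorem theorem1p1:
  fixes a b :: real and V :: "real \<times> real \<Rightarrow> real"
  assumes "a < b"
    and "coercive V" and "lower_semicontinuous V" and "diagonal V" and "symmetric V"
  shows "weakstar_seq_lsc {a<..<b} (J1d V {a<..<b}) \<longleftrightarrow> separately_level_convex V"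
proof
  assume J: "weakstar_seq_lsc {a<..<b} (J1d V {a<..<b})"
  show "separately_level_convex V"
    unfolding separately_level_convex_def
  proof
    fix c
    show "separately_convex (sublevel V c)"
    proof (rule separately_convexI_symmetric)
      show "(\<eta>, \<xi>) \<in> sublevel V c" if "(\<xi>, \<eta>) \<in> sublevel V c" for \<xi> \<eta>
        using that assms(5) by (simp add: sublevel_def symmetric_def)
    qed (rule segment_mem_sublevel_if_lsc[OF assms(1,3,4,5) J])
  qed
next
  assume "separately_level_convex V"
  then show "weakstar_seq_lsc {a<..<b} (J1d V {a<..<b})"
    by (rule lsc_if_separately_level_convex[OF assms(3)])
qed

end
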